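(* Let $r\ge 2$ and let $s,p,n$ be positive integers with $n=5p=2r+s$ and $p+s+2=n+1$. The Shabat polynomials of the two trees with passport $[r^2,1^s;5^p;n]$ are (up to equivalence) given by $Q(P(x))$, where $$P(x)=\frac{(2r-1)!}{((r-1)!)^2\,2^{2r}}\sum_{k=0}^{r-1}\binom{r-1}{k}(10-2\alpha)^{-r+k+1}\frac{x^{2r-2k-1}}{2r-2k-1}-\frac14(1+\alpha),\qquad Q(x)=1-x^5,$$ and $\alpha$ takes the value $\sqrt5$ for one tree and $-\sqrt5$ for the other.
   Context: A Shabat polynomial is a complex polynomial with at most two finite critical values $c_1,c_2$. Its tree is the bicolored plane tree $P^{-1}([c_1,c_2])$, with black vertices the points of $P^{-1}(c_1)$, white vertices the points of $P^{-1}(c_2)$, edges the connected components of the preimage of the open segment $(c_1,c_2)$, and vertex degree equal to the multiplicity of the corresponding root of $P-c_1$ or $P-c_2$. Two Shabat polynomials $P,Q$ (with ordered critical values $c_{1,1},c_{1,2}$ and $c_{2,1},c_{2,2}$) are equivalent if $Q(x)=AP(ax+b)+B$ with $A,a\ne 0$ and $c_{2,j}=Ac_{1,j}+B$ for $j=1,2$; bicolored plane trees (up to color- and orientation-preserving isomorphism) correspond bijectively to Shabat polynomials up to equivalence. The passport $[\alpha;\beta;n]$ of a tree with $n$ edges records the partition $\alpha\vdash n$ of black vertex degrees and $\beta\vdash n$ of white vertex degrees ($k^m$ means $k$ repeated $m$ times). Under the stated conditions there are exactly two trees with passport $[r^2,1^s;5^p;n]$. In the claim, $c_1=0$ and $c_2=1$.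 *)

theory Defs
  imports "HOL-Complex_Analysis.Complex_Analysis" "HOL-Computational_Algebra.Polynomial"
    "HOL-Library.Multiset"
begin

text \<open>The pair \<open>(c1, c2)\<close> is ordered and part of the data. If \<open>f\<close> has fewer than two
  critical values, the remaining entries are arbitrary.\<close>

definition shabat :: "complex poly \<Rightarrow> complex \<Rightarrow> complex \<Rightarrow> bool" where
  "shabat f c1 c2 \<longleftrightarrow> degree f > 0 \<and> c1 \<noteq> c2 \<and>
     (\<forall>z. poly (pderiv f) z = 0 \<longrightarrow> poly f z \<in> {c1, c2})"

definition shabat_equiv ::
  "complex poly \<Rightarrow> complex \<Rightarrow> complex \<Rightarrow> complex poly \<Rightarrow> complex \<Rightarrow> complex \<Rightarrow> bool" where
  "shabat_equiv f c1 c2 g d1 d2 \<longleftrightarrow>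
     (\<exists>A B a b. A \<noteq> 0 \<and> a \<noteq> 0 \<and> g = smult A (f \<circ>\<^sub>p [:b, a:]) + [:B:] \<and>
        d1 = A * c1 + B \<and> d2 = A * c2 + B)"

text \<open>A bicolored plane graph drawn in the complex plane. Edges are point sets that do not contain
  their endpoints, so a vertex \<open>v\<close> is an endpoint of \<open>e\<close> iff it lies in the closure of \<open>e\<close>.\<close>

record plane_tree =
  black :: "complex set"
  white :: "complex set"
  edges :: "complex set set"
  deg :: "complex \<Rightarrow> nat"

definition shabat_tree :: "complex poly \<Rightarrow> complex \<Rightarrow> complex \<Rightarrow> plane_tree" where
  "shabat_tree f c1 c2 =
     \<lparr>black = poly f -` {c1},
      white = poly f -` {c2},
      edges = components (poly f -` open_segment c1 c2),
      deg = (\<lambda>v. order v (f - [:poly f v:]))\<rparr>"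

definition passport :: "plane_tree \<Rightarrow> nat multiset \<times> nat multiset \<times> nat" where
  "passport T =
     (image_mset (deg T) (mset_set (black T)), image_mset (deg T) (mset_set (white T)),
      card (edges T))"

definition incident :: "complex \<Rightarrow> complex set \<Rightarrow> bool" where
  "incident v e \<longleftrightarrow> v \<in> closure e"

text \<open>The unit tangent vector with which the edge \<open>e\<close> leaves its endpoint \<open>v\<close>. At a root of
  multiplicity \<open>m\<close> the incident edges leave at angles that differ by multiples of \<open>2 * pi / m\<close>,
  so the tangents determine the cyclic order of the edges around \<open>v\<close>.\<close>

definition edge_dir :: "complex \<Rightarrow> complex set \<Rightarrow> complex" where
  "edge_dir v e = Lim (at v within e) (\<lambda>z. sgn (z - v))"

text \<open>Turning counterclockwise around \<open>v\<close> from \<open>e1\<close>, one meets \<open>e2\<close> before \<open>e3\<close>.\<close>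

definition ccw :: "complex \<Rightarrow> complex set \<Rightarrow> complex set \<Rightarrow> complex set \<Rightarrow> bool" where
  "ccw v e1 e2 e3 \<longleftrightarrow>
     0 < Arg2pi (edge_dir v e2 / edge_dir v e1) \<and>
     Arg2pi (edge_dir v e2 / edge_dir v e1) < Arg2pi (edge_dir v e3 / edge_dir v e1)"

text \<open>Color- and orientation-preserving isomorphism: a graph isomorphism that respects the colors,
  the degrees and the counterclockwise cyclic order of the edges around each vertex.\<close>

definition tree_iso :: "plane_tree \<Rightarrow> plane_tree \<Rightarrow> bool" where
  "tree_iso S T \<longleftrightarrow>
     (\<exists>\<phi> \<psi>. bij_betw \<phi> (black S) (black T) \<and> bij_betw \<phi> (white S) (white T) \<and>
        bij_betw \<psi> (edges S) (edges T) \<and>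
        (\<forall>v \<in> black S \<union> white S.
           deg T (\<phi> v) = deg S v \<and>
           (\<forall>e \<in> edges S. incident (\<phi> v) (\<psi> e) \<longleftrightarrow> incident v e) \<and>
           (\<forall>e1 \<in> edges S. \<forall>e2 \<in> edges S. \<forall>e3 \<in> edges S.
              incident v e1 \<and> incident v e2 \<and> incident v e3 \<longrightarrow>
              (ccw (\<phi> v) (\<psi> e1) (\<psi> e2) (\<psi> e3) \<longleftrightarrow> ccw v e1 e2 e3))))"

definition P_poly :: "nat \<Rightarrow> complex \<Rightarrow> complex poly" where
  "P_poly r \<alpha> =
     smult (fact (2 * r - 1) / ((fact (r - 1))\<^sup>2 * 2 ^ (2 * r)))
       (\<Sum>k = 0..r - 1.
          monom (of_nat (r - 1 choose k) * (10 - 2 * \<alpha>) powi (- int r + int k + 1)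
                   / of_nat (2 * r - 2 * k - 1))
                (2 * r - 2 * k - 1))
     - [:1 / 4 * (1 + \<alpha>):]"

definition Q_poly :: "complex poly" where
  "Q_poly = 1 - monom 1 5"

definition QP :: "nat \<Rightarrow> complex \<Rightarrow> complex poly" where
  "QP r \<alpha> = Q_poly \<circ>\<^sub>p P_poly r \<alpha>"

end

theory Submission
  imports Defs "HOL-Computational_Algebra.Fundamental_Theorem_Algebra"
begin

text \<open>
  A polynomial with passport \<open>[r^2, 1^s; 5^p; n]\<close> has the form \<open>c1 + (c2 - c1) (1 - h^5)\<close>, where
  \<open>h'\<close> is a multiple of \<open>(x - a)^(r - 1) (x - b)^(r - 1)\<close> and \<open>h a\<close>, \<open>h b\<close> are distinct fifth
  roots of unity. Up to an affine substitution and a factor that is a fifth root of unity, \<open>h\<close> only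
  depends on \<open>{h a / h b, h b / h a}\<close>, which leaves two polynomials, \<open>P\<close> for \<open>\<alpha> = \<plusminus> sqrt 5\<close>.
  As equivalent polynomials have isomorphic trees, it remains to see that these two trees differ.

  Each edge of the tree of \<open>1 - P^5\<close> lies over one of the five rays from \<open>0\<close> to a fifth root of unity,
  and counting shows that every white vertex meets each ray exactly once, in the cyclic order of the
  rays. Since there are \<open>2 r - 1\<close> white vertices, some white vertex is adjacent to both vertices of
  degree \<open>r\<close>. The corresponding rays are neighbours for \<open>\<alpha> = sqrt 5\<close>, but not for \<open>\<alpha> = - sqrt 5\<close>.
\<close>

section \<open>Polynomials as covering maps\<close>

text \<open>Edges are given only as components of a preimage, and their directions only as limits.
  Lifting the segment through a covering turns each edge into the image of a section; the number of
  edges, their ends and their tangents all come from this. Incidences are then found by pairing an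
  injectivity statement with a global count, instead of counting the edges around a multiple root
  locally.

  The implication from isomorphic trees to equivalent polynomials goes through the passport: an
  isomorphism preserves it, so the classification reduces the question to the two explicit trees.

  There are four candidates for the value \<open>\<tau>\<close> of \<open>P\<close> at a critical
  point. Exchanging \<open>\<tau>\<close> and \<open>\<tau> ^ 4\<close> exchanges the two critical
  points, and \<open>\<tau> + \<tau> ^ 4\<close> is a root of \<open>x^2 + x - 1\<close>. This
  leaves two values of \<open>\<alpha> = - 1 - 2 * (\<tau> + \<tau> ^ 4)\<close>, the square roots
  of 5.\<close>

lemma holomorphic_on_poly_eval: "poly f holomorphic_on A" for f :: "complex poly"
  using poly_DERIV by (metis DERIV_subset UNIV_I field_differentiable_def field_differentiable_at_within
      holomorphic_on_def)

lemma poly_locally_injective: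
  fixes f :: "complex poly"
  assumes "poly (pderiv f) z \<noteq> 0"
  obtains \<rho> where "\<rho> > 0" "inj_on (poly f) (ball z \<rho>)"
proof (rule has_complex_derivative_locally_injective [of "poly f" UNIV z])
  show "deriv (poly f) z \<noteq> 0"
    using assms poly_DERIV [of f z] by (metis DERIV_imp_deriv)
qed (auto intro: that holomorphic_on_poly_eval)

lemma card_roots_eq_degree:
  fixes f :: "complex poly"
  assumes "f \<noteq> 0" "\<And>z. poly f z = 0 \<Longrightarrow> poly (pderiv f) z \<noteq> 0"
  shows "card {z. poly f z = 0} = degree f"
proof -
  have "rsquarefree f" using assms(2) by (auto simp: rsquarefree_roots)
  then have "f = smult (lead_coeff f) (\<Prod>z|poly f z = 0. [:-z, 1:])"
    by (simp add: complex_poly_decompose_rsquarefree)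
  moreover have "degree (\<Prod>z|poly f z = 0. [:-z, 1:]) = card {z. poly f z = 0}"
    by (subst degree_prod_sum_eq) auto
  ultimately show ?thesis
    by (metis assms(1) degree_smult_eq leading_coeff_0_iff)
qed

lemma poly_minus_const_neq_0:
  fixes f :: "complex poly"
  assumes "degree f > 0"
  shows "f - [:c:] \<noteq> 0"
  using assms by (metis degree_pCons_0 eq_iff_diff_eq_0 less_irrefl)

lemma finite_poly_fiber:
  fixes f :: "complex poly"
  assumes "degree f > 0"
  shows "finite {z. poly f z = w}"
proof -
  show ?thesis using poly_roots_finite [OF poly_minus_const_neq_0 [OF assms]] by simp
qed

lemma card_poly_fiber:
  fixes f :: "complex poly"
  assumes "degree f > 0" "\<And>z. poly f z = w \<Longrightarrow> poly (pderiv f) z \<noteq> 0"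
  shows "card {z. poly f z = w} = degree f"
proof -
  have "f - [:w:] \<noteq> 0" by (rule poly_minus_const_neq_0 [OF assms(1)])
  moreover have "degree (f - [:w:]) = degree f"
    using assms(1) by (metis diff_conv_add_uminus degree_add_eq_left degree_minus degree_pCons_0)
  ultimately show ?thesis
    using card_roots_eq_degree [of "f - [:w:]"] assms(2) by (simp add: pderiv_diff pderiv_pCons)
qed

text \<open>The inverse function theorem gives a sheet at each of the finitely many points over
  \<open>w\<close>. That nothing else lies over a small neighbourhood of \<open>w\<close> is a
  matter of counting: all fibres over \<open>S\<close> have \<open>degree f\<close> points.\<close>

lemma covering_space_poly:
  fixes f :: "complex poly"
  assumes deg: "degree f > 0" and reg: "\<And>z. poly f z \<in> S \<Longrightarrow> poly (pderiv f) z \<noteq> 0"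
  shows "covering_space (poly f -` S) (poly f) S"
proof
  show "continuous_on (poly f -` S) (poly f)" by (intro continuous_intros)
  have surj: "\<exists>z. poly f z = w" for w
  proof -
    have "\<not> constant (poly (f - [:w:]))"
      using deg by (metis constant_degree diff_conv_add_uminus degree_add_eq_left degree_minus
          degree_pCons_0 less_irrefl)
    then show ?thesis using fundamental_theorem_of_algebra by fastforce
  qed
  show "poly f ` (poly f -` S) = S" using surj by (auto simp: image_iff) (metis vimageI)
  fix w assume "w \<in> S"
  define Z where "Z = {z. poly f z = w}"
  have finZ: "finite Z" using finite_poly_fiber [OF deg] by (simp add: Z_def)
  have "Z \<noteq> {}" using surj by (auto simp: Z_def)
  obtain \<sigma> where \<sigma>: "\<sigma> > 0" "\<And>z z'. z \<in> Z \<Longrightarrow> z' \<in> Z \<Longrightarrow> z \<noteq> z' \<Longrightarrow> \<sigma> < dist z z'"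
  proof -
    have *: "\<exists>\<sigma>>0. \<forall>z'\<in>Z. z' \<noteq> z \<longrightarrow> \<sigma> < dist z z'" for z
    proof -
      obtain d where "d > 0" "\<forall>x\<in>Z. x \<noteq> z \<longrightarrow> d \<le> dist z x"
        using finite_set_avoid [OF finZ] by metis
      then show ?thesis by (intro exI [of _ "d/2"]) force
    qed
    then obtain s where s: "\<And>z. s z > 0" "\<And>z z'. z' \<in> Z \<Longrightarrow> z' \<noteq> z \<Longrightarrow> s z < dist z z'" by metis
    show ?thesis
    proof (rule that [of "Min (s ` Z)"])
      show "Min (s ` Z) > 0" using finZ \<open>Z \<noteq> {}\<close> s by simp
      show "Min (s ` Z) < dist z z'" if "z \<in> Z" "z' \<in> Z" "z \<noteq> z'" for z z'
      proof -
        have "Min (s ` Z) \<le> s z" using finZ that by simp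
        also have "s z < dist z z'" using s(2) that by metis
        finally show ?thesis .
      qed
    qed
  qed
  have "\<exists>\<rho>>0. inj_on (poly f) (ball z \<rho>)" if "z \<in> Z" for z
    using poly_locally_injective [of f z] reg that \<open>w \<in> S\<close> unfolding Z_def by blast
  then obtain \<rho> where \<rho>: "\<And>z. z \<in> Z \<Longrightarrow> \<rho> z > 0" "\<And>z. z \<in> Z \<Longrightarrow> inj_on (poly f) (ball z (\<rho> z))"
    by metis
  define U where "U z = ball z (min (\<rho> z) (\<sigma>/2))" for z
  have opU: "open (U z)" for z by (simp add: U_def)
  have injU: "inj_on (poly f) (U z)" if "z \<in> Z" for z
    using \<rho>(2) [OF that] by (rule inj_on_subset) (auto simp: U_def)
  have memU: "z \<in> U z" if "z \<in> Z" for z using \<rho>(1) [OF that] \<sigma> by (simp add: U_def)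
  have disjU: "U z \<inter> U z' = {}" if "z \<in> Z" "z' \<in> Z" "z \<noteq> z'" for z z'
  proof -
    have "False" if x: "x \<in> U z" "x \<in> U z'" for x
    proof -
      have "dist z x < \<sigma>/2" "dist z' x < \<sigma>/2" using x by (auto simp: U_def)
      moreover have "dist z z' \<le> dist z x + dist z' x" by (rule dist_triangle2)
      ultimately show False using \<sigma>(2) [of z z'] \<open>z \<in> Z\<close> \<open>z' \<in> Z\<close> \<open>z \<noteq> z'\<close> by linarith
    qed
    then show ?thesis by blast
  qed
  define V where "V = (\<Inter>z\<in>Z. poly f ` U z)"
  \<comment> \<open>Images of the discs are open and finite in number, so their intersection is a
    neighbourhood of \<open>w\<close> over which every disc has a point.\<close>
  have opfU: "open (poly f ` U z)" if "z \<in> Z" for z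
    by (rule open_mapping_thm3 [OF _ opU injU [OF that]]) (rule holomorphic_on_poly_eval)
  have opV: "open V" unfolding V_def using finZ opfU by (intro open_INT) auto
  have wV: "w \<in> V" using memU by (force simp: V_def Z_def)
  define T where "T = S \<inter> V"
  define sheet where "sheet z = U z \<inter> poly f -` T" for z
  have img: "poly f ` sheet z = T" if "z \<in> Z" for z
  proof
    show "T \<subseteq> poly f ` sheet z"
    proof
      fix t assume "t \<in> T"
      then have "t \<in> poly f ` U z" using that by (simp add: T_def V_def)
      then show "t \<in> poly f ` sheet z" using \<open>t \<in> T\<close> by (auto simp: sheet_def)
    qed
  qed (auto simp: sheet_def)
  have cardZ: "card Z = degree f" unfolding Z_def
    by (rule card_poly_fiber [OF deg]) (use reg \<open>w \<in> S\<close> in auto)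
  \<comment> \<open>Each of the \<open>card Z = degree f\<close> disjoint sheets already contributes a preimage of \<open>f x\<close>,
    which leaves no room for a preimage outside of them.\<close>
  have cover: "\<Union>(sheet ` Z) = poly f -` S \<inter> poly f -` T"
  proof -
    have "x \<in> \<Union>(sheet ` Z)" if "poly f x \<in> T" for x
    proof -
      have "\<exists>y. y \<in> sheet z \<and> poly f y = poly f x" if "z \<in> Z" for z
        using img [OF that] \<open>poly f x \<in> T\<close> by (metis imageE)
      then obtain y where y: "\<And>z. z \<in> Z \<Longrightarrow> y z \<in> sheet z \<and> poly f (y z) = poly f x" by metis
      have inj: "inj_on y Z"
      proof (rule inj_onI, rule ccontr)
        fix z z' assume "z \<in> Z" "z' \<in> Z" "y z = y z'" "z \<noteq> z'"
        then show False using disjU [of z z'] y [of z] y [of z'] by (auto simp: sheet_def)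
      qed
      have "y ` Z = {t. poly f t = poly f x}"
      proof (rule card_subset_eq)
        show "y ` Z \<subseteq> {t. poly f t = poly f x}" using y by auto
        show "finite {t. poly f t = poly f x}" by (rule finite_poly_fiber [OF deg])
        have "card {t. poly f t = poly f x} = degree f"
          by (rule card_poly_fiber [OF deg]) (use reg that in \<open>auto simp: T_def\<close>)
        then show "card (y ` Z) = card {t. poly f t = poly f x}"
          using card_image [OF inj] cardZ by simp
      qed
      then have "x \<in> y ` Z" by simp
      then obtain z where "z \<in> Z" "x = y z" by (rule imageE)
      then show ?thesis using y [of z] by auto
    qed
    then show ?thesis by (auto simp: sheet_def T_def)
  qed
  show "\<exists>T. w \<in> T \<and> openin (top_of_set S) T \<and>
           (\<exists>v. \<Union>v = poly f -` S \<inter> poly f -` T \<and> (\<forall>u\<in>v. openin (top_of_set (poly f -` S)) u) \<and>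
                pairwise disjnt v \<and> (\<forall>u\<in>v. \<exists>q. homeomorphism u T (poly f) q))"
  proof (intro exI conjI)
    show "w \<in> T" using wV \<open>w \<in> S\<close> by (simp add: T_def)
    show "openin (top_of_set S) T" using opV by (auto simp: T_def)
    show "\<Union>(sheet ` Z) = poly f -` S \<inter> poly f -` T" by (rule cover)
    show "pairwise disjnt (sheet ` Z)"
      using disjU by (fastforce simp: pairwise_def disjnt_def sheet_def)
    show "\<forall>u\<in>sheet ` Z. openin (top_of_set (poly f -` S)) u"
    proof
      fix u assume "u \<in> sheet ` Z"
      then obtain z where "z \<in> Z" and u: "u = sheet z" by blast
      have "open (U z \<inter> poly f -` V)"
        using opU opV by (intro open_Int continuous_open_vimage) (auto intro!: continuous_intros)
      moreover have "u = poly f -` S \<inter> (U z \<inter> poly f -` V)" by (auto simp: u sheet_def T_def)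
      ultimately show "openin (top_of_set (poly f -` S)) u" by (metis openin_open)
    qed
    show "\<forall>u\<in>sheet ` Z. \<exists>q. homeomorphism u T (poly f) q"
    proof
      fix u assume "u \<in> sheet ` Z"
      then obtain z where z: "z \<in> Z" and u: "u = sheet z" by blast
      obtain g where g: "g holomorphic_on (poly f ` U z)" "\<And>x. x \<in> U z \<Longrightarrow> g (poly f x) = x"
        using holomorphic_has_inverse [OF _ opU injU [OF z]] holomorphic_on_poly_eval by metis
      have "homeomorphism u T (poly f) g"
      proof (rule homeomorphismI)
        show "continuous_on u (poly f)" by (intro continuous_intros)
        show "continuous_on T g"
          using g(1) z by (intro continuous_on_subset [OF holomorphic_on_imp_continuous_on])
            (auto simp: T_def V_def)
        show "poly f ` u \<subseteq> T" using img [OF z] u by auto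
        show gf: "\<And>x. x \<in> u \<Longrightarrow> g (poly f x) = x" using g(2) u by (simp add: sheet_def)
        show "g ` T \<subseteq> u" using gf img [OF z] u by force
        show "\<And>y. y \<in> T \<Longrightarrow> poly f (g y) = y" using gf img [OF z] u by (metis imageE)
      qed
      then show "\<exists>q. homeomorphism u T (poly f) q" by blast
    qed
  qed
qed

section \<open>Edges\<close>

lemma sgn_power_eq: "sgn (x ^ n) = sgn x ^ n" for x :: "'a::real_normed_div_algebra"
  by (induction n) (simp_all add: Real_Vector_Spaces.sgn_mult)

locale edge_poly =
  fixes f :: "complex poly" and c1 c2 :: complex
  assumes deg_pos: "degree f > 0" and distinct: "c1 \<noteq> c2"
    and regular: "\<And>z. poly f z \<in> open_segment c1 c2 \<Longrightarrow> poly (pderiv f) z \<noteq> 0"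
begin

abbreviation "seg \<equiv> open_segment c1 c2"

abbreviation "es \<equiv> components (poly f -` seg)"

text \<open>The segment is simply connected, so the covering has a section \<open>g\<close> through
  any point of the edge. Its image is closed in the full preimage, as the solution set of
  \<open>g (poly f x) = x\<close>, and open there because \<open>f\<close> is locally injective. A
  connected clopen part of the preimage that meets the edge is the whole edge.\<close>

lemma edge_section:
  assumes "e \<in> es"
  obtains g where "continuous_on seg g" "e = g ` seg" "\<And>w. w \<in> seg \<Longrightarrow> poly f (g w) = w"
proof -
  let ?X = "poly f -` seg"
  obtain z where z: "z \<in> e" using assms in_components_nonempty by blast
  have eX: "e \<subseteq> ?X" using assms in_components_subset by blast
  obtain g where g: "continuous_on seg g" "g \<in> seg \<rightarrow> ?X" "g (poly f z) = z"
      "\<And>w. w \<in> seg \<Longrightarrow> poly f (g w) = w"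
  proof (rule covering_space_lift_strong [OF covering_space_poly [OF deg_pos regular], of seg z "poly f z" seg "\<lambda>x. x"])
    show "simply_connected seg" "locally path_connected seg"
      by (auto intro: convex_imp_simply_connected convex_imp_locally_path_connected convex_open_segment)
  qed (use z eX in auto)
  define C where "C = g ` seg"
  have gf: "x \<in> C \<longleftrightarrow> x \<in> ?X \<and> g (poly f x) = x" for x
    unfolding C_def using g(4) by force
  have contgf: "continuous_on ?X (\<lambda>x. g (poly f x))"
    by (rule continuous_on_compose2 [OF g(1)]) (auto intro: continuous_intros)
  have "closedin (top_of_set ?X) {x \<in> ?X. g (poly f x) - x = 0}"
    by (intro continuous_closedin_preimage_constant continuous_intros contgf)
  moreover have "{x \<in> ?X. g (poly f x) - x = 0} = C" using gf by auto
  ultimately have clo: "closedin (top_of_set ?X) C" by simp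
  have opn: "openin (top_of_set ?X) C"
    unfolding openin_euclidean_subtopology_iff
  proof (intro conjI ballI)
    show "C \<subseteq> ?X" using gf by auto
    fix x assume "x \<in> C"
    then have x: "x \<in> ?X" "g (poly f x) = x" using gf by auto
    obtain \<rho> where \<rho>: "\<rho> > 0" "inj_on (poly f) (ball x \<rho>)"
      using poly_locally_injective regular x by blast
    obtain \<delta> where \<delta>: "\<delta> > 0" "\<And>y. y \<in> ?X \<Longrightarrow> dist y x < \<delta> \<Longrightarrow> dist (g (poly f y)) x < \<rho>"
      using contgf x \<rho>(1) unfolding continuous_on_iff by metis
    show "\<exists>d>0. \<forall>y\<in>?X. dist y x < d \<longrightarrow> y \<in> C"
    proof (intro exI [of _ "min \<delta> \<rho>"] conjI ballI impI)
      show "min \<delta> \<rho> > 0" using \<delta> \<rho> by simp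
      fix y assume y: "y \<in> ?X" "dist y x < min \<delta> \<rho>"
      then have "poly f (g (poly f y)) = poly f y" using g(4) by auto
      moreover have "g (poly f y) \<in> ball x \<rho>" "y \<in> ball x \<rho>"
        using \<delta>(2) [of y] y by (auto simp: dist_commute)
      ultimately have "g (poly f y) = y" using \<rho>(2) by (meson inj_onD)
      then show "y \<in> C" using gf y by blast
    qed
  qed
  have conC: "connected C"
    unfolding C_def by (intro connected_continuous_image g(1) convex_connected convex_open_segment)
  have "z \<in> C" using gf z eX g(3) by auto
  then have Ce: "C \<subseteq> e"
    using components_maximal [OF assms conC] gf z by blast
  have "connected e" using assms in_components_connected by blast
  moreover have "openin (top_of_set e) C" "closedin (top_of_set e) C"
    using opn clo Ce eX by (auto intro: openin_subset_trans closedin_subset_trans)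
  ultimately have "C = e" using \<open>z \<in> C\<close> unfolding connected_clopen by blast
  then show ?thesis using that g C_def by blast
qed

lemma edge_image: "e \<in> es \<Longrightarrow> poly f ` e = seg"
  by (rule edge_section) (auto simp: image_image)

lemma edge_inj: "e \<in> es \<Longrightarrow> inj_on (poly f) e"
  by (rule edge_section) (auto intro!: inj_onI)

lemma edge_connected: "e \<in> es \<Longrightarrow> connected e"
  using in_components_connected by blast

lemma edges_eqI: "\<lbrakk>e \<in> es; e' \<in> es; z \<in> e; z \<in> e'\<rbrakk> \<Longrightarrow> e = e'"
  using components_eq by blast

lemma seg_nonempty: "seg \<noteq> {}"
  using distinct by (simp add: open_segment_eq_empty)

text \<open>An edge contains exactly one point over a chosen \<open>w\<close> of the segment, so the
  edges are indexed by a regular fibre.\<close>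

lemma card_edges: "card es = degree f"
proof -
  obtain w where w: "w \<in> seg" using seg_nonempty by blast
  let ?X = "poly f -` seg"
  have X: "z \<in> ?X" if "poly f z = w" for z using that w by simp
  have "bij_betw (connected_component_set ?X) {z. poly f z = w} es"
  proof (rule bij_betwI')
    fix x y assume x: "x \<in> {z. poly f z = w}" and y: "y \<in> {z. poly f z = w}"
    show "connected_component_set ?X x = connected_component_set ?X y \<longleftrightarrow> x = y"
    proof
      assume eq: "connected_component_set ?X x = connected_component_set ?X y"
      have "x \<in> connected_component_set ?X x" "y \<in> connected_component_set ?X y"
        using X x y by (simp_all add: connected_component_refl_eq)
      then have "x \<in> connected_component_set ?X x" "y \<in> connected_component_set ?X x"
        unfolding eq by auto
      moreover have "inj_on (poly f) (connected_component_set ?X x)"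
        using X x by (intro edge_inj componentsI) auto
      ultimately show "x = y" using x y by (auto dest: inj_onD)
    qed simp
  next
    fix x assume "x \<in> {z. poly f z = w}"
    then show "connected_component_set ?X x \<in> es" using X by (intro componentsI) auto
  next
    fix e assume e: "e \<in> es"
    then obtain z where z: "z \<in> e" "poly f z = w" using edge_image w by (metis imageE)
    then have "e = connected_component_set ?X z"
      using e X by (intro edges_eqI [of _ _ z]) (auto intro: componentsI simp: connected_component_refl_eq)
    then show "\<exists>x\<in>{z. poly f z = w}. e = connected_component_set ?X x" using z by blast
  qed
  then have "card es = card {z. poly f z = w}" by (simp add: bij_betw_same_card)
  also have "\<dots> = degree f" by (rule card_poly_fiber [OF deg_pos]) (use regular w in auto)
  finally show ?thesis .
qed

lemma finite_edges: "finite es"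
  using card_edges deg_pos by (metis card.infinite less_irrefl)

section \<open>Endpoints and tangents of edges\<close>

lemma edge_bounded:
  assumes "e \<in> es"
  shows "bounded e"
proof -
  obtain B where B: "\<And>w. w \<in> seg \<Longrightarrow> norm w \<le> B"
    using bounded_open_segment bounded_iff by metis
  obtain a p where f: "f = pCons a p" by (cases f)
  have "p \<noteq> 0" using deg_pos f by auto
  from poly_infinity [OF this, of "B + 1" a]
  obtain r where r: "\<And>z. r \<le> norm z \<Longrightarrow> B + 1 \<le> norm (poly f z)" unfolding f by blast
  have "norm z \<le> r" if "z \<in> e" for z
  proof -
    have "norm (poly f z) \<le> B" using B edge_image assms that by blast
    then show ?thesis using r [of z] by linarith
  qed
  then show ?thesis by (auto simp: bounded_iff)
qed

text \<open>The closure of an edge is compact, so its image is closed; containing the open segment,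
  it contains both ends as well.\<close>

lemma edge_endpoint:
  assumes "e \<in> es" "c \<in> {c1, c2}"
  obtains v where "v \<in> closure e" "poly f v = c"
proof -
  have "compact (poly f ` closure e)"
    using edge_bounded [OF assms(1)]
    by (intro compact_continuous_image continuous_intros) (simp add: compact_closure)
  moreover have "seg \<subseteq> poly f ` closure e"
    using edge_image [OF assms(1)] closure_subset by blast
  ultimately have "closure seg \<subseteq> poly f ` closure e"
    by (intro closure_minimal compact_imp_closed)
  moreover have "c \<in> closure seg" using assms(2) distinct by (auto simp: closure_open_segment)
  ultimately show ?thesis using that by blast
qed

text \<open>The minimum of \<open>|f - c|\<close> on a small circle around \<open>v\<close> that avoids the fibre over \<open>c\<close>
  yields \<open>\<epsilon>\<close>: the connected part of the edge over \<open>ball c \<epsilon>\<close> cannot cross the circle.\<close>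

lemma edge_near_endpoint:
  assumes e: "e \<in> es" and v: "v \<in> closure e" "poly f v = c" and "\<delta> > 0"
  obtains \<epsilon> where "\<epsilon> > 0" "connected (e \<inter> poly f -` ball c \<epsilon>)" "e \<inter> poly f -` ball c \<epsilon> \<subseteq> ball v \<delta>"
proof -
  obtain d where d: "d > 0" "\<And>z. poly f z = c \<Longrightarrow> z \<noteq> v \<Longrightarrow> d \<le> dist v z"
    using finite_set_avoid [OF finite_poly_fiber [OF deg_pos, of c], of v] by auto
  define \<delta>' where "\<delta>' = min \<delta> (d / 2)"
  have \<delta>': "\<delta>' > 0" "\<delta>' \<le> \<delta>" "\<delta>' < d" using d(1) \<open>\<delta> > 0\<close> by (auto simp: \<delta>'_def)
  have "v + of_real \<delta>' \<in> sphere v \<delta>'" using \<delta>'(1) by (simp add: dist_norm)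
  then have "sphere v \<delta>' \<noteq> {}" by blast
  moreover have "continuous_on (sphere v \<delta>') (\<lambda>z. norm (poly f z - c))" by (intro continuous_intros)
  ultimately obtain x where x: "x \<in> sphere v \<delta>'"
      "\<And>y. y \<in> sphere v \<delta>' \<Longrightarrow> norm (poly f x - c) \<le> norm (poly f y - c)"
    using continuous_attains_inf [OF compact_sphere] by metis
  define \<epsilon> where "\<epsilon> = norm (poly f x - c)"
  have "poly f x \<noteq> c" using x(1) d(2) [of x] \<delta>' by (auto simp: dist_commute)
  then have \<epsilon>: "\<epsilon> > 0" by (simp add: \<epsilon>_def)
  define D where "D = e \<inter> poly f -` ball c \<epsilon>"
  obtain g where g: "continuous_on seg g" "e = g ` seg" "\<And>w. w \<in> seg \<Longrightarrow> poly f (g w) = w"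
    using edge_section [OF e] by blast
  have "D = g ` (seg \<inter> ball c \<epsilon>)" using g by (auto simp: D_def)
  moreover have "connected (seg \<inter> ball c \<epsilon>)"
    by (intro convex_connected convex_Int convex_open_segment convex_ball)
  ultimately have conD: "connected D"
    using g(1) by (auto intro!: connected_continuous_image intro: continuous_on_subset)
  have "D \<inter> frontier (ball v \<delta>') = {}"
    using x(2) \<delta>' by (fastforce simp: D_def \<epsilon>_def dist_norm norm_minus_commute)
  moreover have "D \<inter> ball v \<delta>' \<noteq> {}"
  proof -
    have "open (ball v \<delta>' \<inter> poly f -` ball c \<epsilon>)"
      by (intro open_Int continuous_open_vimage) (auto intro!: continuous_intros)
    moreover have "v \<in> ball v \<delta>' \<inter> poly f -` ball c \<epsilon>" using v \<delta>' \<epsilon> by simp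
    ultimately have "ball v \<delta>' \<inter> poly f -` ball c \<epsilon> \<inter> e \<noteq> {}"
      using v(1) by (metis closure_iff_nhds_not_empty inf_commute order_refl)
    then show ?thesis by (auto simp: D_def)
  qed
  ultimately have "D \<subseteq> ball v \<delta>'" using connected_Int_frontier [OF conD, of "ball v \<delta>'"] by blast
  also have "\<dots> \<subseteq> ball v \<delta>" using \<delta>' by auto
  finally show ?thesis using that \<epsilon> conD unfolding D_def by blast
qed

lemma edge_meets_near_endpoint:
  assumes "e \<in> es" "c \<in> {c1, c2}" "\<epsilon> > 0"
  shows "seg \<inter> ball c \<epsilon> \<noteq> {}"
proof -
  have "c \<in> closure seg" using assms(2) distinct by (auto simp: closure_open_segment)
  then show ?thesis using assms(3) by (meson closure_iff_nhds_not_empty open_ball centre_in_ball order_refl)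
qed

lemma endpoint_notin_edge:
  assumes "e \<in> es" "c \<in> {c1, c2}" "poly f v = c"
  shows "v \<notin> e"
  using edge_image [OF assms(1)] assms(2,3) by (auto simp: open_segment_def)

text \<open>This makes the limit in \<open>edge_dir\<close> unique, so that \<open>Lim\<close> can
  be evaluated by exhibiting a limit.\<close>

lemma endpoint_filter_nontrivial:
  assumes "e \<in> es" "c \<in> {c1, c2}" "poly f v = c" "v \<in> closure e"
  shows "at v within e \<noteq> bot"
  using endpoint_notin_edge [OF assms(1-3)] assms(4)
  by (metis closure_approachable islimpt_approachable trivial_limit_within)

text \<open>Near \<open>v\<close> one has \<open>f z - c = poly q v * ((z - v) * k z) ^ m\<close> with a continuous \<open>k\<close>, \<open>k v = 1\<close>.
  On the edge the direction of \<open>f z - c\<close> is constant, so the direction of \<open>(z - v) * k z\<close> takes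
  finitely many values, hence only one by connectedness.\<close>

lemma edge_tangent:
  assumes e: "e \<in> es" and c: "c \<in> {c1, c2}" and v: "poly f v = c" "v \<in> closure e"
  shows "((\<lambda>z. sgn (z - v)) \<longlongrightarrow> edge_dir v e) (at v within e)"
proof -
  define m where "m = order v (f - [:c:])"
  have nz: "f - [:c:] \<noteq> 0" by (rule poly_minus_const_neq_0 [OF deg_pos])
  obtain q where q: "f - [:c:] = [:- v, 1:] ^ m * q" "\<not> [:- v, 1:] dvd q"
    using order_decomp [OF nz] m_def by blast
  have m: "m > 0" using nz v(1) by (simp add: m_def order_gt_0_iff)
  have qv: "poly q v \<noteq> 0" using q(2) by (simp add: poly_eq_0_iff_dvd)
  have fz: "poly f z - c = (z - v) ^ m * poly q z" for z
    using arg_cong [OF q(1), of "\<lambda>p. poly p z"] by simp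
  \<comment> \<open>The principal \<open>m\<close>-th root of \<open>poly q z / poly q v\<close>. It
    is continuous on the disc chosen next, where this quotient stays in the right
    half-plane.\<close>
  define k where "k z = exp (Ln (poly q z / poly q v) / of_nat m)" for z
  have "open ((\<lambda>z. poly q z / poly q v) -` {z. Re z > 0})"
    by (intro continuous_open_vimage open_halfspace_Re_gt) (use qv in \<open>auto intro!: continuous_intros\<close>)
  then obtain \<delta> where \<delta>: "\<delta> > 0" "ball v \<delta> \<subseteq> (\<lambda>z. poly q z / poly q v) -` {z. Re z > 0}"
    using qv openE by (metis (mono_tags, lifting) div_self mem_Collect_eq one_complex.sel(1) vimageI2 zero_less_one)
  have Re: "Re (poly q z / poly q v) > 0" if "z \<in> ball v \<delta>" for z using \<delta>(2) that by blast
  have slit: "poly q z / poly q v \<notin> \<real>\<^sub>\<le>\<^sub>0" if "z \<in> ball v \<delta>" for z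
    using Re [OF that] by (simp add: complex_nonpos_Reals_iff del: divide_complex_def)
  have "continuous_on (ball v \<delta>) (\<lambda>z. Ln (poly q z / poly q v))"
  proof (rule continuous_on_Ln')
    show "continuous_on (ball v \<delta>) (\<lambda>z. poly q z / poly q v)"
      using qv by (intro continuous_intros) auto
  qed (rule slit)
  then have contk: "continuous_on (ball v \<delta>) k"
    unfolding k_def using m by (intro continuous_on_exp continuous_on_divide continuous_on_const) auto
  have km: "k z ^ m = poly q z / poly q v" if "z \<in> ball v \<delta>" for z
  proof -
    have "poly q z / poly q v \<noteq> 0" using Re [OF that] by auto
    then show ?thesis using m by (simp add: k_def flip: exp_of_nat_mult)
  qed
  have knz: "k z \<noteq> 0" for z by (simp add: k_def)
  have kv: "k v = 1" using qv by (simp add: k_def)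
  obtain \<epsilon> where \<epsilon>: "\<epsilon> > 0" "connected (e \<inter> poly f -` ball c \<epsilon>)" "e \<inter> poly f -` ball c \<epsilon> \<subseteq> ball v \<delta>"
    using edge_near_endpoint [OF e v(2,1) \<delta>(1)] by metis
  define D where "D = e \<inter> poly f -` ball c \<epsilon>"
  define h where "h z = sgn ((z - v) * k z)" for z
  obtain u where u: "\<And>w. w \<in> seg \<Longrightarrow> sgn (w - c) = u"
  proof -
    have "sgn (w - c1) = sgn (c2 - c1) \<and> sgn (w - c2) = sgn (c1 - c2)" if "w \<in> seg" for w
    proof -
      obtain t where t: "0 < t" "t < 1" "w = (1 - t) *\<^sub>R c1 + t *\<^sub>R c2"
        using \<open>w \<in> seg\<close> by (auto simp: in_segment)
      have "w - c1 = t *\<^sub>R (c2 - c1)" "w - c2 = (1 - t) *\<^sub>R (c1 - c2)"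
        using t(3) by (simp_all add: scaleR_conv_of_real algebra_simps)
      then show ?thesis using t by (simp add: sgn_scaleR)
    qed
    then show ?thesis using that c by blast
  qed
  have zv: "z \<noteq> v" if "z \<in> e" for z using endpoint_notin_edge [OF e c v(1)] that by blast
  have Dball: "z \<in> ball v \<delta>" if "z \<in> D" for z using \<epsilon>(3) that D_def by blast
  have hm: "h z ^ m = u / sgn (poly q v)" if "z \<in> D" for z
  proof -
    have "((z - v) * k z) ^ m = (poly f z - c) / poly q v"
      using km [OF Dball [OF that]] fz [of z] by (simp add: power_mult_distrib)
    moreover have "sgn ((poly f z - c) / poly q v) = u / sgn (poly q v)"
      using u edge_image [OF e] that by (auto simp: D_def sgn_divide)
    moreover have "h z ^ m = sgn (((z - v) * k z) ^ m)"
      by (simp add: h_def sgn_power_eq)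
    ultimately show ?thesis by simp
  qed
  have "h constant_on D"
  proof (rule continuous_finite_range_constant)
    show "connected D" using \<epsilon>(2) by (simp add: D_def)
    show "continuous_on D h"
      unfolding h_def sgn_div_norm
      by (intro continuous_intros continuous_on_subset [OF contk])
         (use Dball zv knz in \<open>auto simp: D_def\<close>)
    have "finite {x. poly (monom 1 m - [:u / sgn (poly q v):]) x = 0}"
    proof (rule poly_roots_finite)
      have "coeff (monom 1 m - [:u / sgn (poly q v):]) m = 1" using m by (simp add: coeff_pCons split: nat.split)
      then show "monom 1 m - [:u / sgn (poly q v):] \<noteq> 0" by (metis coeff_0 zero_neq_one)
    qed
    moreover have "h ` D \<subseteq> {x. poly (monom 1 m - [:u / sgn (poly q v):]) x = 0}"
      using hm by (auto simp: poly_monom)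
    ultimately show "finite (h ` D)" using finite_subset by blast
  qed
  then obtain \<omega> where \<omega>: "\<And>z. z \<in> D \<Longrightarrow> h z = \<omega>" by (auto simp: constant_on_def)
  \<comment> \<open>With \<open>h\<close> constantly \<open>\<omega>\<close>, the direction of
    \<open>z - v\<close> is \<open>\<omega> / sgn (k z)\<close>, which converges because
    \<open>k\<close> is continuous and nonzero at \<open>v\<close>.\<close>
  have "((\<lambda>z. \<omega> / sgn (k z)) \<longlongrightarrow> \<omega> / sgn (k v)) (at v within e)"
  proof -
    have "isCont k v" using contk \<delta>(1) by (simp add: continuous_on_eq_continuous_at)
    then have "(k \<longlongrightarrow> k v) (at v within e)"
      using continuous_at_imp_continuous_at_within continuous_within by blast
    then show ?thesis using knz kv by (intro tendsto_intros) (auto simp: sgn_zero_iff)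
  qed
  moreover have "\<forall>\<^sub>F z in at v within e. \<omega> / sgn (k z) = sgn (z - v)"
  proof -
    have "(poly f \<longlongrightarrow> c) (at v within e)"
      using poly_isCont v(1) by (metis Lim_at_imp_Lim_at_within isCont_def)
    then have "\<forall>\<^sub>F z in at v within e. z \<in> poly f -` ball c \<epsilon>"
      using topological_tendstoD [of "poly f" c _ "ball c \<epsilon>"] \<epsilon>(1) by simp
    moreover have "\<forall>\<^sub>F z in at v within e. z \<in> e" by (simp add: eventually_at_topological) blast
    ultimately show ?thesis
    proof eventually_elim
      case (elim z)
      then have "h z = \<omega>" using \<omega> by (simp add: D_def)
      then show ?case using knz [of z] by (auto simp: h_def Real_Vector_Spaces.sgn_mult sgn_zero_iff)
    qed
  qed
  ultimately have lim: "((\<lambda>z. sgn (z - v)) \<longlongrightarrow> \<omega> / sgn (k v)) (at v within e)"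
    by (rule Lim_transform_eventually)
  then show ?thesis
    using tendsto_Lim [OF endpoint_filter_nontrivial [OF e c v] lim] by (simp add: edge_dir_def)
qed

end

lemma edge_poly_shabat: "shabat f c1 c2 \<Longrightarrow> edge_poly f c1 c2"
  unfolding shabat_def edge_poly_def by (auto simp: open_segment_def)

section \<open>Isomorphism of trees\<close>

lemma pcompose_power: "(p ^ n) \<circ>\<^sub>p q = (p \<circ>\<^sub>p q) ^ n" for p :: "'a::comm_semiring_1 poly"
  by (induction n) (simp_all add: pcompose_mult pcompose_1)

lemma order_linear_power_mult:
  fixes q :: "'a::idom poly"
  assumes "poly q x \<noteq> 0"
  shows "order x ([:- x, 1:] ^ m * q) = m"
proof -
  have "q \<noteq> 0" using assms by auto
  then show ?thesis using assms by (subst order_mult) (auto simp: order_power_n_n order_0I)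
qed

lemma order_pcompose_linear:
  fixes f :: "'a::field poly"
  assumes "a \<noteq> 0" "f \<noteq> 0"
  shows "order x (f \<circ>\<^sub>p [:b, a:]) = order (b + a * x) f"
proof -
  define z where "z = b + a * x"
  obtain q where q: "f = [:- z, 1:] ^ order z f * q" "\<not> [:- z, 1:] dvd q"
    using order_decomp [OF assms(2)] by blast
  have lin: "[:- z, 1:] \<circ>\<^sub>p [:b, a:] = smult a [:- x, 1:]"
    by (simp add: pcompose_pCons z_def)
  have "f \<circ>\<^sub>p [:b, a:] = smult (a ^ order z f) ([:- x, 1:] ^ order z f * (q \<circ>\<^sub>p [:b, a:]))"
    by (subst q(1)) (simp only: pcompose_mult pcompose_power lin smult_power mult_smult_left)
  moreover have "poly (q \<circ>\<^sub>p [:b, a:]) x \<noteq> 0"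
    using q(2) by (simp add: poly_pcompose poly_eq_0_iff_dvd z_def algebra_simps)
  ultimately show ?thesis
    using assms(1) by (simp add: order_smult order_linear_power_mult z_def)
qed

lemma open_segment_affine_iff:
  fixes A B :: complex
  assumes "A \<noteq> 0"
  shows "A * w + B \<in> open_segment (A * c1 + B) (A * c2 + B) \<longleftrightarrow> w \<in> open_segment c1 c2"
proof -
  have "A * w + B = (1 - t) *\<^sub>R (A * c1 + B) + t *\<^sub>R (A * c2 + B) \<longleftrightarrow>
        w = (1 - t) *\<^sub>R c1 + t *\<^sub>R c2" for t
  proof -
    have "(1 - t) *\<^sub>R (A * c1 + B) + t *\<^sub>R (A * c2 + B) = A * ((1 - t) *\<^sub>R c1 + t *\<^sub>R c2) + B"
      by (simp add: scaleR_conv_of_real algebra_simps)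
    then show ?thesis using assms by simp
  qed
  then show ?thesis using assms by (simp add: in_segment)
qed

lemma components_homeomorphic_image:
  assumes "homeomorphism X Y h k"
  shows "components Y = (`) h ` components X"
proof -
  have "connected_component_set Y (h x) = h ` connected_component_set X x" if "x \<in> X" for x
    using connected_component_set_homeomorphism [OF assms that] .
  moreover have "Y = h ` X" using assms by (simp add: homeomorphism_def)
  ultimately show ?thesis unfolding components_def by (force simp: image_image)
qed

text \<open>The isomorphism is the inverse \<open>T\<close> of the affine substitution. It divides
  every tangent by \<open>sgn a\<close>, and \<open>ccw\<close> sees only quotients of tangents.
  Transporting \<open>edge_dir\<close> requires that the original limit exists, which is what
  \<open>edge_tangent\<close> provides.\<close>

lemma shabat_equiv_imp_tree_iso:
  assumes f: "shabat f c1 c2" and equiv: "shabat_equiv f c1 c2 g d1 d2"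
  shows "tree_iso (shabat_tree f c1 c2) (shabat_tree g d1 d2)"
proof -
  interpret edge_poly f c1 c2 using f by (rule edge_poly_shabat)
  obtain A B a b where "A \<noteq> 0" "a \<noteq> 0" and g: "g = smult A (f \<circ>\<^sub>p [:b, a:]) + [:B:]"
      and d: "d1 = A * c1 + B" "d2 = A * c2 + B"
    using equiv unfolding shabat_equiv_def by blast
  define S where "S z = b + a * z" for z
  define T where "T z = (z - b) / a" for z
  have ST [simp]: "S (T z) = z" "T (S z) = z" for z
    using \<open>a \<noteq> 0\<close> by (simp_all add: S_def T_def)
  have contS: "continuous_on X S" and contT: "continuous_on X T" for X
    unfolding S_def T_def using \<open>a \<noteq> 0\<close> by (auto intro!: continuous_intros)
  have homT: "homeomorphism X (T ` X) T S" for X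
    by (rule homeomorphismI) (auto simp: contS contT)
  have injT: "inj_on T X" for X by (metis ST(1) inj_onI)
  have gS: "poly g z = A * poly f (S z) + B" for z
    by (simp add: g poly_pcompose S_def algebra_simps)
  have memT: "x \<in> T ` X \<longleftrightarrow> S x \<in> X" for x X by (metis ST image_iff)
  have blackg: "poly g -` {d1} = T ` (poly f -` {c1})" and whiteg: "poly g -` {d2} = T ` (poly f -` {c2})"
    using \<open>A \<noteq> 0\<close> by (auto simp: memT gS d)
  have "poly g -` open_segment d1 d2 = T ` (poly f -` seg)"
    using \<open>A \<noteq> 0\<close> by (auto simp: memT gS d open_segment_affine_iff)
  then have edgesg: "components (poly g -` open_segment d1 d2) = (`) T ` es"
    using components_homeomorphic_image [OF homT] by metis
  have degg: "order (T v) (g - [:poly g (T v):]) = order v (f - [:poly f v:])" for v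
  proof -
    have "f - [:poly f v:] \<noteq> 0"
      by (rule poly_minus_const_neq_0 [OF deg_pos])
    moreover have "g - [:poly g (T v):] = smult A ((f - [:poly f v:]) \<circ>\<^sub>p [:b, a:])"
      by (simp add: gS pcompose_diff smult_diff_right) (simp add: g)
    ultimately have "order (T v) (g - [:poly g (T v):]) = order (S (T v)) (f - [:poly f v:])"
      using \<open>A \<noteq> 0\<close> \<open>a \<noteq> 0\<close> by (simp add: order_smult order_pcompose_linear S_def)
    then show ?thesis by simp
  qed
  have clos: "T v \<in> closure (T ` e) \<longleftrightarrow> v \<in> closure e" for v e
  proof -
    have "homeomorphism UNIV UNIV T S" using homT [of UNIV] by (metis ST(2) surjI)
    then have "closure (T ` e) = T ` closure e"
      by (intro closure_bij_homeomorphic_image_eq [where A = UNIV and B = UNIV and A' = UNIV and B' = UNIV and g = S])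
        (auto simp: bij_betw_def injT contS contT memT)
    then show ?thesis by (simp add: memT)
  qed
  have dir: "edge_dir (T v) (T ` e) = edge_dir v e / sgn a"
    if "e \<in> es" "v \<in> closure e" "poly f v \<in> {c1, c2}" for v e
  proof -
    have "filterlim S (at v within e) (at (T v) within T ` e)"
      unfolding filterlim_at
    proof
      show "\<forall>\<^sub>F y in at (T v) within T ` e. S y \<in> e \<and> S y \<noteq> v"
        unfolding eventually_at_topological by (metis ST(1,2) memT open_UNIV UNIV_I)
      have "isCont S (T v)" using contS [of UNIV] by (simp add: continuous_on_eq_continuous_at)
      then show "(S \<longlongrightarrow> v) (at (T v) within T ` e)"
        by (metis Lim_at_imp_Lim_at_within ST(1) isCont_def)
    qed
    then have "((\<lambda>y. sgn (S y - v)) \<longlongrightarrow> edge_dir v e) (at (T v) within T ` e)"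
      using filterlim_compose [OF edge_tangent] that by blast
    then have "((\<lambda>y. sgn (S y - v) / sgn a) \<longlongrightarrow> edge_dir v e / sgn a) (at (T v) within T ` e)"
      using \<open>a \<noteq> 0\<close> by (intro tendsto_intros) (auto simp: sgn_zero_iff)
    moreover have "sgn (S y - v) / sgn a = sgn (y - T v)" for y
    proof -
      have "y - T v = (S y - v) / a" using \<open>a \<noteq> 0\<close> by (simp add: S_def T_def field_simps)
      then show ?thesis by (simp add: sgn_divide)
    qed
    moreover have "at (T v) within T ` e \<noteq> bot"
    proof -
      have "T v \<notin> T ` e" using endpoint_notin_edge [OF that(1) that(3)] by (simp add: memT)
      then show ?thesis using clos [of v e] that(2)
        by (metis closure_approachable islimpt_approachable trivial_limit_within)
    qed
    ultimately show ?thesis unfolding edge_dir_def [of "T v"] by (simp add: tendsto_Lim)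
  qed
  have ccw: "ccw (T v) (T ` e1) (T ` e2) (T ` e3) \<longleftrightarrow> ccw v e1 e2 e3"
    if "e1 \<in> es" "e2 \<in> es" "e3 \<in> es" "v \<in> closure e1" "v \<in> closure e2" "v \<in> closure e3"
       "poly f v \<in> {c1, c2}" for v e1 e2 e3
    using that \<open>a \<noteq> 0\<close> by (simp add: ccw_def dir sgn_zero_iff)
  show ?thesis
    unfolding tree_iso_def
  proof (intro exI [of _ T] exI [of _ "(`) T"] conjI)
    show "bij_betw T (black (shabat_tree f c1 c2)) (black (shabat_tree g d1 d2))"
      "bij_betw T (white (shabat_tree f c1 c2)) (white (shabat_tree g d1 d2))"
      by (simp_all add: shabat_tree_def blackg whiteg bij_betw_def injT)
    have "inj_on ((`) T) es" by (intro inj_on_image injT)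
    then show "bij_betw ((`) T) (edges (shabat_tree f c1 c2)) (edges (shabat_tree g d1 d2))"
      by (simp add: shabat_tree_def edgesg bij_betw_def)
  qed (auto simp: shabat_tree_def degg incident_def clos ccw)
qed

section \<open>Formal properties of tree isomorphism\<close>

lemma tree_iso_trans:
  assumes "tree_iso R S" "tree_iso S T"
  shows "tree_iso R T"
proof -
  obtain \<phi> \<psi> where 1: "bij_betw \<phi> (black R) (black S)" "bij_betw \<phi> (white R) (white S)"
      "bij_betw \<psi> (edges R) (edges S)"
    and 2: "\<And>v. v \<in> black R \<union> white R \<Longrightarrow> deg S (\<phi> v) = deg R v"
      "\<And>v e. v \<in> black R \<union> white R \<Longrightarrow> e \<in> edges R \<Longrightarrow> incident (\<phi> v) (\<psi> e) \<longleftrightarrow> incident v e"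
      "\<And>v e1 e2 e3. v \<in> black R \<union> white R \<Longrightarrow> e1 \<in> edges R \<Longrightarrow> e2 \<in> edges R \<Longrightarrow> e3 \<in> edges R \<Longrightarrow>
        incident v e1 \<and> incident v e2 \<and> incident v e3 \<Longrightarrow>
        ccw (\<phi> v) (\<psi> e1) (\<psi> e2) (\<psi> e3) \<longleftrightarrow> ccw v e1 e2 e3"
    using assms(1) unfolding tree_iso_def by blast
  obtain \<phi>' \<psi>' where 3: "bij_betw \<phi>' (black S) (black T)" "bij_betw \<phi>' (white S) (white T)"
      "bij_betw \<psi>' (edges S) (edges T)"
    and 4: "\<And>v. v \<in> black S \<union> white S \<Longrightarrow> deg T (\<phi>' v) = deg S v"
      "\<And>v e. v \<in> black S \<union> white S \<Longrightarrow> e \<in> edges S \<Longrightarrow> incident (\<phi>' v) (\<psi>' e) \<longleftrightarrow> incident v e"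
      "\<And>v e1 e2 e3. v \<in> black S \<union> white S \<Longrightarrow> e1 \<in> edges S \<Longrightarrow> e2 \<in> edges S \<Longrightarrow> e3 \<in> edges S \<Longrightarrow>
        incident v e1 \<and> incident v e2 \<and> incident v e3 \<Longrightarrow>
        ccw (\<phi>' v) (\<psi>' e1) (\<psi>' e2) (\<psi>' e3) \<longleftrightarrow> ccw v e1 e2 e3"
    using assms(2) unfolding tree_iso_def by blast
  have m: "\<phi> v \<in> black S \<union> white S" if "v \<in> black R \<union> white R" for v
    using 1 that by (auto dest: bij_betwE)
  have n: "\<psi> e \<in> edges S" if "e \<in> edges R" for e using 1 that by (auto dest: bij_betwE)
  show ?thesis
    unfolding tree_iso_def
  proof (intro exI [of _ "\<phi>' \<circ> \<phi>"] exI [of _ "\<psi>' \<circ> \<psi>"] conjI ballI impI)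
    show "bij_betw (\<phi>' \<circ> \<phi>) (black R) (black T)" "bij_betw (\<phi>' \<circ> \<phi>) (white R) (white T)"
      "bij_betw (\<psi>' \<circ> \<psi>) (edges R) (edges T)"
      using 1 3 by (auto intro: bij_betw_trans)
  next
    fix v assume v: "v \<in> black R \<union> white R"
    show "deg T ((\<phi>' \<circ> \<phi>) v) = deg R v" using 2(1) 4(1) m v by simp
    fix e1 assume e1: "e1 \<in> edges R"
    show "incident ((\<phi>' \<circ> \<phi>) v) ((\<psi>' \<circ> \<psi>) e1) \<longleftrightarrow> incident v e1"
      using 2(2) 4(2) m n v e1 by simp
    fix e2 e3 assume "e2 \<in> edges R" "e3 \<in> edges R" "incident v e1 \<and> incident v e2 \<and> incident v e3"
    then show "ccw ((\<phi>' \<circ> \<phi>) v) ((\<psi>' \<circ> \<psi>) e1) ((\<psi>' \<circ> \<psi>) e2) ((\<psi>' \<circ> \<psi>) e3) \<longleftrightarrow> ccw v e1 e2 e3"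
      using 2(2,3) 4(3) m n v e1 by simp
  qed
qed

text \<open>Disjoint colour classes make \<open>\<phi>\<close> a bijection on all vertices, so that
  a single inverse serves both colours.\<close>

lemma tree_iso_sym:
  assumes "tree_iso S T" "black S \<inter> white S = {}" "black T \<inter> white T = {}"
  shows "tree_iso T S"
proof -
  obtain \<phi> \<psi> where 1: "bij_betw \<phi> (black S) (black T)" "bij_betw \<phi> (white S) (white T)"
      "bij_betw \<psi> (edges S) (edges T)"
    and 2: "\<And>v. v \<in> black S \<union> white S \<Longrightarrow> deg T (\<phi> v) = deg S v"
      "\<And>v e. v \<in> black S \<union> white S \<Longrightarrow> e \<in> edges S \<Longrightarrow> incident (\<phi> v) (\<psi> e) \<longleftrightarrow> incident v e"
      "\<And>v e1 e2 e3. v \<in> black S \<union> white S \<Longrightarrow> e1 \<in> edges S \<Longrightarrow> e2 \<in> edges S \<Longrightarrow> e3 \<in> edges S \<Longrightarrow>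
        incident v e1 \<and> incident v e2 \<and> incident v e3 \<Longrightarrow>
        ccw (\<phi> v) (\<psi> e1) (\<psi> e2) (\<psi> e3) \<longleftrightarrow> ccw v e1 e2 e3"
    using assms(1) unfolding tree_iso_def by blast
  have bij: "bij_betw \<phi> (black S \<union> white S) (black T \<union> white T)"
    using 1(1,2) assms(3) by (rule bij_betw_combine)
  define \<phi>' where "\<phi>' = inv_into (black S \<union> white S) \<phi>"
  define \<psi>' where "\<psi>' = inv_into (edges S) \<psi>"
  have \<phi>': "\<phi>' v \<in> black S \<union> white S" "\<phi> (\<phi>' v) = v" if "v \<in> black T \<union> white T" for v
    using bij that unfolding \<phi>'_def
    by (metis bij_betw_inv_into bij_betwE, metis bij_betw_inv_into_right)
  have \<psi>': "\<psi>' e \<in> edges S" "\<psi> (\<psi>' e) = e" if "e \<in> edges T" for e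
    using 1(3) that unfolding \<psi>'_def
    by (metis bij_betw_inv_into bij_betwE, metis bij_betw_inv_into_right)
  show ?thesis
    unfolding tree_iso_def
  proof (intro exI [of _ \<phi>'] exI [of _ \<psi>'] conjI ballI impI)
    show "bij_betw \<phi>' (black T) (black S)" "bij_betw \<phi>' (white T) (white S)"
      using bij_betw_inv_into_subset [OF bij, of "black S" "black T"]
        bij_betw_inv_into_subset [OF bij, of "white S" "white T"] 1(1,2)
      by (auto simp: \<phi>'_def bij_betw_def)
    show "bij_betw \<psi>' (edges T) (edges S)" unfolding \<psi>'_def by (rule bij_betw_inv_into [OF 1(3)])
  next
    fix v assume v: "v \<in> black T \<union> white T"
    show "deg S (\<phi>' v) = deg T v" using 2(1) \<phi>' [OF v] by metis
    fix e1 assume e1: "e1 \<in> edges T"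
    show "incident (\<phi>' v) (\<psi>' e1) \<longleftrightarrow> incident v e1"
      using 2(2) \<phi>' [OF v] \<psi>' [OF e1] by metis
    fix e2 e3 assume e: "e2 \<in> edges T" "e3 \<in> edges T" and inc: "incident v e1 \<and> incident v e2 \<and> incident v e3"
    have "incident (\<phi>' v) (\<psi>' e1) \<and> incident (\<phi>' v) (\<psi>' e2) \<and> incident (\<phi>' v) (\<psi>' e3)"
      using inc 2(2) \<phi>' [OF v] \<psi>' e e1 by metis
    then show "ccw (\<phi>' v) (\<psi>' e1) (\<psi>' e2) (\<psi>' e3) \<longleftrightarrow> ccw v e1 e2 e3"
      using 2(3) [OF \<phi>'(1) [OF v] \<psi>'(1) [OF e1] \<psi>'(1) [OF e(1)] \<psi>'(1) [OF e(2)]]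
        \<phi>'(2) [OF v] \<psi>'(2) e e1 by metis
  qed
qed

lemma tree_iso_passport:
  assumes "tree_iso S T"
  shows "passport S = passport T"
proof -
  obtain \<phi> \<psi> where 1: "bij_betw \<phi> (black S) (black T)" "bij_betw \<phi> (white S) (white T)"
      "bij_betw \<psi> (edges S) (edges T)"
    and 2: "\<And>v. v \<in> black S \<union> white S \<Longrightarrow> deg T (\<phi> v) = deg S v"
    using assms unfolding tree_iso_def by blast
  have "image_mset (deg S) (mset_set X) = image_mset (deg T) (mset_set Y)"
    if "bij_betw \<phi> X Y" "X \<subseteq> black S \<union> white S" for X Y
  proof (cases "finite X")
    case True
    have "mset_set Y = image_mset \<phi> (mset_set X)"
      using that(1) by (auto simp: bij_betw_def image_mset_mset_set)
    then have "image_mset (deg T) (mset_set Y) = image_mset (\<lambda>v. deg T (\<phi> v)) (mset_set X)"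
      by (simp add: multiset.map_comp o_def)
    also have "\<dots> = image_mset (deg S) (mset_set X)"
      using 2 that(2) True by (intro image_mset_cong) auto
    finally show ?thesis by simp
  next
    case False
    then have "infinite Y" using that(1) bij_betw_finite by blast
    then show ?thesis using False by simp
  qed
  from this [OF 1(1)] this [OF 1(2)] show ?thesis
    using bij_betw_same_card [OF 1(3)] by (simp add: passport_def)
qed

section \<open>The polynomials P and Q\<close>

lemma sum_order_eq_degree:
  fixes p :: "complex poly"
  assumes "p \<noteq> 0"
  shows "(\<Sum>z | poly p z = 0. order z p) = degree p"
proof -
  have "degree p = sum (count (proots p)) (set_mset (proots p))"
    by (simp add: size_proots_complex flip: size_multiset_overloaded_eq)
  also have "\<dots> = (\<Sum>z | poly p z = 0. order z p)"
    using assms by simp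
  finally show ?thesis by simp
qed

section \<open>Alternating binomial sums of reciprocals\<close>

lemma sum_binomial_Suc:
  fixes g :: "nat \<Rightarrow> 'a::comm_semiring_1"
  shows "(\<Sum>k\<le>Suc n. of_nat (Suc n choose k) * g k) =
    (\<Sum>k\<le>n. of_nat (n choose k) * g k) + (\<Sum>k\<le>n. of_nat (n choose k) * g (Suc k))"
proof -
  have "(\<Sum>k\<le>n. of_nat (n choose k) * g k) = (\<Sum>k\<le>Suc n. of_nat (n choose k) * g k)"
    by (simp add: binomial_eq_0)
  also have "\<dots> = g 0 + (\<Sum>k\<le>n. of_nat (n choose Suc k) * g (Suc k))"
    by (simp add: sum.atMost_Suc_shift del: sum.atMost_Suc)
  finally show ?thesis
    by (simp add: sum.atMost_Suc_shift sum.distrib algebra_simps del: sum.atMost_Suc)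
qed

text \<open>Both sides are the beta integral of \<open>t^(x-1) (1-t)^n\<close> over [0, 1]. Pascal's
  rule writes the sum for \<open>Suc n\<close> as the difference of the sums for \<open>n\<close> at
  \<open>x\<close> and at \<open>x + 1\<close>, which is why the induction is over all
  \<open>x\<close>.\<close>

lemma sum_binomial_alternating_reciprocal:
  fixes x :: real
  assumes "x > 0"
  shows "(\<Sum>k\<le>n. of_nat (n choose k) * ((- 1) ^ k / (x + of_nat k))) = fact n / pochhammer x (Suc n)"
  using assms
proof (induction n arbitrary: x)
  case (Suc n)
  have pos: "pochhammer (x + 1) n > 0" using Suc.prems by (simp add: pochhammer_pos)
  have "(\<Sum>k\<le>Suc n. of_nat (Suc n choose k) * ((- 1) ^ k / (x + of_nat k))) =
      (\<Sum>k\<le>n. of_nat (n choose k) * ((- 1) ^ k / (x + of_nat k)))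
      - (\<Sum>k\<le>n. of_nat (n choose k) * ((- 1) ^ k / ((x + 1) + of_nat k)))"
    unfolding sum_binomial_Suc by (simp add: sum_negf algebra_simps)
  also have "\<dots> = fact n / pochhammer x (Suc n) - fact n / pochhammer (x + 1) (Suc n)"
    using Suc.IH [of x] Suc.IH [of "x + 1"] Suc.prems by simp
  also have "pochhammer x (Suc n) = x * pochhammer (x + 1) n" by (rule pochhammer_rec)
  also have "pochhammer (x + 1) (Suc n) = (x + 1 + of_nat n) * pochhammer (x + 1) n" by (rule pochhammer_rec')
  also have "fact n / (x * pochhammer (x + 1) n) - fact n / ((x + 1 + of_nat n) * pochhammer (x + 1) n)
      = fact (Suc n) / (x * ((x + 1 + of_nat n) * pochhammer (x + 1) n))"
    using pos Suc.prems by (simp add: divide_simps) (simp add: algebra_simps)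
  also have "x * ((x + 1 + of_nat n) * pochhammer (x + 1) n) = pochhammer x (Suc (Suc n))"
    by (simp add: pochhammer_rec [of x "Suc n"] pochhammer_rec' [of "x + 1" n])
  finally show ?case .
qed simp

text \<open>The previous sum at \<open>x = 1/2\<close>. The value is the integral of
  \<open>(1 - t^2)^n\<close> over [0, 1], which measures how far \<open>P\<close> rises from 0 to a
  critical point after rescaling.\<close>

lemma sum_binomial_alternating_odd_reciprocal:
  "(\<Sum>k\<le>n. of_nat (n choose k) * ((- 1) ^ k / of_nat (2 * k + 1))) =
     (4 ^ n * (fact n)\<^sup>2 / fact (2 * n + 1) :: real)"
proof -
  have half: "(- 1) ^ k / (1/2 + real k) = 2 * ((- 1) ^ k / real (2 * k + 1))" for k
  proof -
    have "1/2 + real k = real (2 * k + 1) / 2" by simp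
    then show ?thesis by (simp only: divide_divide_eq_right) simp
  qed
  have "(\<Sum>k\<le>n. of_nat (n choose k) * ((- 1) ^ k / of_nat (2 * k + 1))) =
      (\<Sum>k\<le>n. of_nat (n choose k) * ((- 1) ^ k / (1/2 + of_nat k))) / (2::real)"
  proof -
    have "C * (2 * X) / 2 = C * X" for C X :: real by simp
    then show ?thesis unfolding sum_divide_distrib half by (simp only:)
  qed
  also have "\<dots> = fact n / (2 * pochhammer (1/2) (Suc n))"
    by (subst sum_binomial_alternating_reciprocal) auto
  also have "\<dots> = 4 ^ n * (fact n)\<^sup>2 / fact (2 * n + 1)"
  proof -
    have "pochhammer (1/2 :: real) (Suc n) > 0" by (simp add: pochhammer_pos)
    moreover have "fact (2 * n + 1) = 2 * 4 ^ n * pochhammer (1/2) (Suc n) * (fact n :: real)"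
    proof -
      have "(2 * of_nat n + 2) * fact (2 * n + 1) = (fact (2 * Suc n) :: real)"
        by (simp add: algebra_simps)
      also have "\<dots> = 2 ^ (2 * Suc n) * pochhammer (1/2) (Suc n) * fact (Suc n)"
        by (rule fact_double)
      also have "(2::real) ^ (2 * Suc n) = 4 * 4 ^ n" by (simp add: power_mult)
      also have "4 * 4 ^ n * pochhammer (1/2) (Suc n) * fact (Suc n) =
          (2 * of_nat n + 2) * (2 * 4 ^ n * pochhammer (1/2) (Suc n) * (fact n :: real))"
        by (simp add: algebra_simps)
      finally have "(2 * of_nat n + 2) * fact (2 * n + 1) =
          (2 * of_nat n + 2) * (2 * 4 ^ n * pochhammer (1/2) (Suc n) * (fact n :: real))" .
      moreover have "2 * of_nat n + 2 \<noteq> (0::real)" by (simp add: add_nonneg_eq_0_iff)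
      ultimately show ?thesis by (metis mult_left_cancel)
    qed
    ultimately show ?thesis by (simp add: divide_simps power2_eq_square)
  qed
  finally show ?thesis .
qed

section \<open>The polynomial P and its critical points\<close>

lemma QP_altdef: "QP r \<alpha> = 1 - P_poly r \<alpha> ^ 5"
proof -
  have "monom 1 5 \<circ>\<^sub>p p = p ^ 5" for p :: "complex poly"
    by (simp add: monom_altdef pcompose_power pcompose_pCons)
  then show ?thesis by (simp add: QP_def Q_poly_def pcompose_diff pcompose_1)
qed

definition P_factor :: "nat \<Rightarrow> complex" where
  "P_factor r = fact (2 * r - 1) / ((fact (r - 1))\<^sup>2 * 2 ^ (2 * r))"

lemma P_factor_nonzero: "P_factor r \<noteq> 0" by (simp add: P_factor_def)

text \<open>Reversing the summation by \<open>k \<mapsto> r - 1 - k\<close> turns the negative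
  exponents into powers of \<open>1 / (10 - 2 * \<alpha>)\<close>, the form in which a binomial
  expansion becomes visible.\<close>

lemma P_poly_altdef:
  assumes "r \<ge> 1"
  shows "P_poly r \<alpha> =
    smult (P_factor r) (\<Sum>k\<le>r - 1. monom (of_nat (r - 1 choose k) * (1 / (10 - 2 * \<alpha>)) ^ k
      / of_nat (2 * k + 1)) (2 * k + 1)) - [:(1 + \<alpha>) / 4:]"
proof -
  have "(\<Sum>k = 0..r - 1.
          monom (of_nat (r - 1 choose k) * (10 - 2 * \<alpha>) powi (- int r + int k + 1)
                   / of_nat (2 * r - 2 * k - 1)) (2 * r - 2 * k - 1)) =
      (\<Sum>k\<le>r - 1. monom (of_nat (r - 1 choose k) * (1 / (10 - 2 * \<alpha>)) ^ k
      / of_nat (2 * k + 1)) (2 * k + 1))"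
  proof (rule sum.reindex_bij_witness [where i = "\<lambda>k. r - 1 - k" and j = "\<lambda>k. r - 1 - k"])
    fix k assume k: "k \<in> {0..r - 1}"
    have 1: "2 * r - 2 * k - 1 = 2 * (r - 1 - k) + 1" using k assms by auto
    have exponent: "- int r + int k + 1 = - int (r - 1 - k)" using k assms by auto
    have 2: "(10 - 2 * \<alpha>) powi (- int r + int k + 1) = (1 / (10 - 2 * \<alpha>)) ^ (r - 1 - k)"
      unfolding exponent power_int_minus power_int_of_nat by (simp add: power_one_over inverse_eq_divide)
    have 3: "(r - 1 choose k) = (r - 1 choose (r - 1 - k))" using k by (intro binomial_symmetric) simp
    show "monom (of_nat (r - 1 choose (r - 1 - k)) * (1 / (10 - 2 * \<alpha>)) ^ (r - 1 - k)
      / of_nat (2 * (r - 1 - k) + 1)) (2 * (r - 1 - k) + 1) =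
      monom (of_nat (r - 1 choose k) * (10 - 2 * \<alpha>) powi (- int r + int k + 1)
                   / of_nat (2 * r - 2 * k - 1)) (2 * r - 2 * k - 1)"
      by (simp only: 1 2 3 [symmetric])
  qed auto
  then show ?thesis by (simp add: P_poly_def P_factor_def add_divide_distrib)
qed

lemma pderiv_sum: "pderiv (sum f A) = (\<Sum>x\<in>A. pderiv (f x))"
  by (induction A rule: infinite_finite_induct) (simp_all add: pderiv_add)

text \<open>Differentiation cancels the odd denominators and leaves the binomial theorem. Hence
  \<open>P\<close> is, up to constants, the antiderivative of a power of a quadratic, with two
  critical points of equal order.\<close>

lemma pderiv_P_poly:
  assumes "r \<ge> 1"
  shows "pderiv (P_poly r \<alpha>) = smult (P_factor r) ([:1, 0, 1 / (10 - 2 * \<alpha>):] ^ (r - 1))"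
proof -
  let ?d = "1 / (10 - 2 * \<alpha>)"
  have "[:1, 0, ?d:] = monom ?d 2 + 1"
    by (simp add: monom_altdef power2_eq_square one_pCons)
  then have "[:1, 0, ?d:] ^ (r - 1) = (\<Sum>k\<le>r - 1. of_nat (r - 1 choose k) * monom ?d 2 ^ k)"
    by (simp add: binomial_ring)
  also have "\<dots> = (\<Sum>k\<le>r - 1. monom (of_nat (r - 1 choose k) * ?d ^ k) (2 * k))"
    by (simp add: monom_power of_nat_poly smult_monom mult.commute)
  also have "\<dots> = (\<Sum>k\<le>r - 1. pderiv (monom (of_nat (r - 1 choose k) * ?d ^ k
      / of_nat (2 * k + 1)) (2 * k + 1)))"
    by (intro sum.cong refl) (simp only: pderiv_monom, simp del: of_nat_Suc of_nat_add)
  finally show ?thesis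
    using assms by (simp add: P_poly_altdef pderiv_diff pderiv_smult pderiv_pCons pderiv_sum)
qed

text \<open>The constant in front of the sum is chosen so that the alternating sum of reciprocals
  of odd numbers that appears at a critical point collapses to \<open>1/4\<close>.\<close>

lemma P_poly_critical:
  assumes "r \<ge> 1" "y\<^sup>2 = - (10 - 2 * \<alpha>)" "10 - 2 * \<alpha> \<noteq> 0"
  shows "poly (P_poly r \<alpha>) y = (y - 1 - \<alpha>) / 4"
proof -
  define n where "n = r - 1"
  have r: "r = Suc n" using assms(1) by (simp add: n_def)
  have "y ^ (2 * k + 1) * (1 / (10 - 2 * \<alpha>)) ^ k = y * (- 1) ^ k" for k
  proof -
    have "y ^ (2 * k + 1) = y * (y\<^sup>2) ^ k" by (simp add: power_mult)
    then have "y ^ (2 * k + 1) * (1 / (10 - 2 * \<alpha>)) ^ k = y * (y\<^sup>2 * (1 / (10 - 2 * \<alpha>))) ^ k"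
      by (simp only: power_mult_distrib mult.assoc)
    also have "y\<^sup>2 * (1 / (10 - 2 * \<alpha>)) = -1"
      unfolding assms(2) using assms(3) by (simp add: divide_simps)
    finally show ?thesis .
  qed
  note power_crit = this
  have *: "poly (monom (of_nat (n choose k) * (1 / (10 - 2 * \<alpha>)) ^ k / of_nat (2 * k + 1)) (2 * k + 1)) y
      = y * (of_nat (n choose k) * ((- 1) ^ k / of_nat (2 * k + 1)))" for k
  proof -
    have "C * D / N * Y = C * (Y * D) / N" "C * (y * D) / N = y * (C * (D / N))" for C D N Y :: complex
      by simp_all
    then show ?thesis by (simp only: poly_monom power_crit)
  qed
  have "poly (P_poly r \<alpha>) y = P_factor r * (\<Sum>k\<le>n. y * (of_nat (n choose k) * ((- 1) ^ k / of_nat (2 * k + 1))))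
      - (1 + \<alpha>) / 4"
    using assms(1) by (simp only: P_poly_altdef n_def [symmetric] poly_diff poly_smult poly_sum *) simp
  also have "(\<Sum>k\<le>n. y * (of_nat (n choose k) * ((- 1) ^ k / of_nat (2 * k + 1)))) =
      y * of_real (\<Sum>k\<le>n. of_nat (n choose k) * ((- 1) ^ k / of_nat (2 * k + 1)))"
    by (simp add: sum_distrib_left)
  also have "P_factor r * (y * of_real (\<Sum>k\<le>n. of_nat (n choose k) * ((- 1) ^ k / of_nat (2 * k + 1)))) = y / 4"
  proof -
    have "of_nat (1 + 2 * n) \<noteq> (0 :: complex)" by (simp only: of_nat_eq_0_iff)
    then show ?thesis
      unfolding sum_binomial_alternating_odd_reciprocal P_factor_def r by (simp add: power_mult)
  qed
  finally show ?thesis by (simp add: diff_divide_distrib add_divide_distrib)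
qed

text \<open>The root of unity \<open>\<tau>\<close> is the value of \<open>P\<close> at the critical point \<open>y\<close> below, and \<open>\<tau> ^ 4 = 1 / \<tau>\<close>
  the value at the other critical point \<open>- y\<close>.\<close>

locale fifth_root_data =
  fixes r :: nat and \<alpha> \<tau> :: complex
  assumes r: "r \<ge> 2" and tau5: "\<tau> ^ 5 = 1" and tau1: "\<tau> \<noteq> 1"
    and alpha: "\<alpha> = - 1 - 2 * (\<tau> + \<tau> ^ 4)"
begin

abbreviation "P \<equiv> P_poly r \<alpha>"

text \<open>A square root of \<open>- (10 - 2 * \<alpha>)\<close>, hence a critical point.
  Expressing it through \<open>\<tau>\<close> fixes its sign.\<close>

definition "y = 2 * (\<tau> - \<tau> ^ 4)"

lemma cyclotomic: "\<tau> ^ 4 + \<tau> ^ 3 + \<tau>\<^sup>2 + \<tau> + 1 = 0"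
proof -
  have "(\<tau> - 1) * (\<tau> ^ 4 + \<tau> ^ 3 + \<tau>\<^sup>2 + \<tau> + 1) = \<tau> ^ 5 - 1" by algebra
  then show ?thesis using tau5 tau1 by simp
qed

text \<open>By the cyclotomic relation \<open>\<tau> + \<tau> ^ 4\<close> solves
  \<open>x^2 + x - 1 = 0\<close>, and \<open>\<alpha>\<close> is a square root of the discriminant
  of this equation.\<close>

lemma alpha_sq: "\<alpha>\<^sup>2 = 5"
  using cyclotomic tau5 alpha by algebra

lemma y_sq: "y\<^sup>2 = - (10 - 2 * \<alpha>)"
  using cyclotomic tau5 alpha unfolding y_def by algebra

lemma tau_nonzero: "\<tau> \<noteq> 0"
  using tau5 by auto

lemma tau_neq_inverse: "\<tau> \<noteq> \<tau> ^ 4"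
proof
  assume "\<tau> = \<tau> ^ 4"
  then have "\<tau> = 1" using tau5 cyclotomic tau_nonzero by algebra
  then show False using tau1 by simp
qed

lemma tau4_5: "(\<tau> ^ 4) ^ 5 = 1"
  using tau5 by (metis mult.commute power_mult power_one)

lemma y_nonzero: "y \<noteq> 0"
  using tau_neq_inverse by (simp add: y_def)

lemma den_nonzero: "10 - 2 * \<alpha> \<noteq> 0"
  using y_sq y_nonzero by auto

text \<open>Here \<open>- 1 - \<alpha>\<close> and \<open>y\<close> are twice the sum and twice the
  difference of \<open>\<tau>\<close> and \<open>\<tau> ^ 4\<close>, so
  \<open>(\<plusminus> y - 1 - \<alpha>) / 4\<close> isolates one of the two. This is the role of
  the constant term of \<open>P\<close>.\<close>

lemma P_y: "poly P y = \<tau>" and P_minus_y: "poly P (- y) = \<tau> ^ 4"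
proof -
  have "poly P y = (y - 1 - \<alpha>) / 4" "poly P (- y) = (- y - 1 - \<alpha>) / 4"
    using P_poly_critical [of r y \<alpha>] P_poly_critical [of r "- y" \<alpha>] r y_sq den_nonzero
    by simp_all
  then show "poly P y = \<tau>" "poly P (- y) = \<tau> ^ 4"
    by (simp_all add: y_def alpha)
qed

lemma pderiv_P:
  obtains c where "c \<noteq> 0" "pderiv P = smult c ([:- y, 1:] ^ (r - 1) * [:y, 1:] ^ (r - 1))"
proof
  let ?d = "1 / (10 - 2 * \<alpha>)"
  have "?d * y\<^sup>2 = -1" using y_sq den_nonzero by (simp add: divide_simps)
  then have "[:1, 0, ?d:] = smult ?d ([:- y, 1:] * [:y, 1:])" by (simp add: power2_eq_square)
  then show "pderiv P = smult (P_factor r * ?d ^ (r - 1)) ([:- y, 1:] ^ (r - 1) * [:y, 1:] ^ (r - 1))"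
    using r by (simp add: pderiv_P_poly smult_power power_mult_distrib del: mult_pCons_left mult_pCons_right)
  show "P_factor r * ?d ^ (r - 1) \<noteq> 0" using P_factor_nonzero den_nonzero by simp
qed

lemma critical_iff: "poly (pderiv P) z = 0 \<longleftrightarrow> z = y \<or> z = - y"
proof -
  obtain c where "c \<noteq> 0" "pderiv P = smult c ([:- y, 1:] ^ (r - 1) * [:y, 1:] ^ (r - 1))"
    by (rule pderiv_P)
  then show ?thesis using r by (auto simp: eq_neg_iff_add_eq_0 add.commute)
qed

lemma degree_P: "degree P = 2 * r - 1"
proof -
  obtain c where c: "c \<noteq> 0" "pderiv P = smult c ([:- y, 1:] ^ (r - 1) * [:y, 1:] ^ (r - 1))"
    by (rule pderiv_P)
  have "degree (pderiv P) = (r - 1) + (r - 1)"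
    unfolding c(2) using c(1) by (simp add: degree_mult_eq degree_power_eq)
  then show ?thesis using r by (simp add: degree_pderiv)
qed

section \<open>Critical values, vertex degrees and passport of QP\<close>

lemma poly_QP: "poly (QP r \<alpha>) z = 1 - poly P z ^ 5"
  by (simp add: QP_altdef)

lemma pderiv_QP: "pderiv (QP r \<alpha>) = smult (- 5) (P ^ 4 * pderiv P)"
proof -
  have "pderiv (P ^ Suc 4) = smult 5 (P ^ 4 * pderiv P)"
    by (simp only: pderiv_power_Suc) simp
  then show ?thesis by (simp add: QP_altdef pderiv_diff pderiv_1)
qed

lemma degree_QP: "degree (QP r \<alpha>) = 10 * r - 5"
proof -
  have "P \<noteq> 0" using degree_P r by auto
  then have deg: "degree (- (P ^ 5)) = 10 * r - 5" by (simp add: degree_power_eq degree_P)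
  have "degree (1 + - (P ^ 5)) = degree (- (P ^ 5))"
    by (rule degree_add_eq_right) (use deg r in simp)
  then show ?thesis using deg by (simp add: QP_altdef)
qed

text \<open>By the chain rule a critical point is either a zero of \<open>P\<close>, lying over 1,
  or one of \<open>\<plusminus> y\<close>, where \<open>P\<close> is a fifth root of unity, lying
  over 0.\<close>

lemma shabat_QP: "shabat (QP r \<alpha>) 0 1"
proof -
  have "poly (QP r \<alpha>) z = 0 \<or> poly (QP r \<alpha>) z = 1" if "poly (pderiv (QP r \<alpha>)) z = 0" for z
  proof (cases "poly P z = 0")
    case False
    then have "z = y \<or> z = - y" using that by (simp add: pderiv_QP critical_iff)
    then have "poly P z ^ 5 = 1" using tau5 tau4_5 P_y P_minus_y by auto
    then show ?thesis by (simp add: poly_QP)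
  qed (simp add: poly_QP)
  then show ?thesis using r by (auto simp: shabat_def degree_QP)
qed

sublocale edge_poly "QP r \<alpha>" 0 1
  by (rule edge_poly_shabat [OF shabat_QP])

lemma order_QP_simple:
  assumes "poly P v \<noteq> 0" "v \<noteq> y" "v \<noteq> - y" "poly (QP r \<alpha>) v = 0"
  shows "order v (QP r \<alpha>) = 1"
proof -
  have "poly (pderiv (QP r \<alpha>)) v \<noteq> 0" using assms by (simp add: pderiv_QP critical_iff)
  moreover have "QP r \<alpha> \<noteq> 0" using deg_pos by auto
  ultimately show ?thesis using assms(4) by (simp add: order_pderiv order_0I)
qed

lemma order_QP_critical:
  assumes "v = y \<or> v = - y"
  shows "order v (QP r \<alpha>) = r"
proof -
  obtain c where c: "c \<noteq> 0" "pderiv P = smult c ([:- y, 1:] ^ (r - 1) * [:y, 1:] ^ (r - 1))"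
    by (rule pderiv_P)
  \<comment> \<open>Naming the other critical point treats \<open>y\<close> and \<open>- y\<close>
    in one computation.\<close>
  define u where "u = - v"
  have "pderiv P = smult c ([:- v, 1:] ^ (r - 1) * [:- u, 1:] ^ (r - 1))"
    using assms c(2) by (auto simp: u_def mult.commute)
  then have "pderiv (QP r \<alpha>) = [:- v, 1:] ^ (r - 1) * (smult (- 5 * c) (P ^ 4 * [:- u, 1:] ^ (r - 1)))"
    unfolding pderiv_QP by (simp add: mult_ac)
  moreover have "poly P v \<noteq> 0" using assms P_y P_minus_y tau_nonzero by auto
  then have "poly (smult (- 5 * c) (P ^ 4 * [:- u, 1:] ^ (r - 1))) v \<noteq> 0"
    using c(1) assms y_nonzero by (auto simp: u_def)
  ultimately have "order v (pderiv (QP r \<alpha>)) = r - 1"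
    by (metis order_linear_power_mult)
  moreover have "QP r \<alpha> \<noteq> 0" using deg_pos by auto
  moreover have "poly (QP r \<alpha>) v = 0"
    using assms tau5 tau4_5 P_y P_minus_y by (auto simp: poly_QP)
  ultimately show ?thesis using r by (simp add: order_pderiv)
qed

lemma white_QP_iff: "poly (QP r \<alpha>) v = 1 \<longleftrightarrow> poly P v = 0"
  by (simp add: poly_QP)

lemma order_QP_white:
  assumes "poly (QP r \<alpha>) v = 1"
  shows "order v (QP r \<alpha> - [:1:]) = 5"
proof -
  have root: "poly P v = 0" using assms by (simp add: white_QP_iff)
  have P0: "P \<noteq> 0" using degree_P r by auto
  have "poly (pderiv P) v \<noteq> 0"
    using root P_y P_minus_y tau_nonzero by (auto simp: critical_iff)
  then have "order v P = 1" using root P0 by (simp add: order_pderiv order_0I)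
  then obtain q where q: "P = [:- v, 1:] * q" "\<not> [:- v, 1:] dvd q"
    using order_decomp [OF P0, of v] by auto
  have "QP r \<alpha> - [:1:] = [:- v, 1:] ^ 5 * (- (q ^ 5))"
    unfolding QP_altdef by (subst q(1)) (simp add: one_pCons power_mult_distrib del: mult_pCons_left)
  moreover have "poly (- (q ^ 5)) v \<noteq> 0" using q(2) by (simp add: poly_eq_0_iff_dvd)
  ultimately show ?thesis by (metis order_linear_power_mult)
qed

lemma finite_black: "finite (poly (QP r \<alpha>) -` {0})" and finite_white: "finite (poly (QP r \<alpha>) -` {1})"
  using finite_poly_fiber [OF deg_pos] by (simp_all add: vimage_def)

text \<open>The critical values of \<open>P\<close> are nonzero, so all its roots are
  simple.\<close>

lemma card_white: "card (poly (QP r \<alpha>) -` {1}) = 2 * r - 1"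
proof -
  have "card {v. poly P v = 0} = degree P"
  proof (rule card_roots_eq_degree)
    show "P \<noteq> 0" using degree_P r by auto
    show "\<And>v. poly P v = 0 \<Longrightarrow> poly (pderiv P) v \<noteq> 0"
      using P_y P_minus_y tau_nonzero by (auto simp: critical_iff)
  qed
  then show ?thesis by (simp add: vimage_def white_QP_iff degree_P)
qed

lemma y_neq_minus_y: "y \<noteq> - y"
  using y_nonzero by (simp add: eq_neg_iff_add_eq_0)

lemma black_critical: "{y, - y} \<subseteq> poly (QP r \<alpha>) -` {0}"
  using tau5 tau4_5 by (simp add: poly_QP P_y P_minus_y flip: power_mult)

lemma order_QP_black_simple:
  assumes "v \<in> poly (QP r \<alpha>) -` {0} - {y, - y}"
  shows "order v (QP r \<alpha>) = 1"
  using assms by (intro order_QP_simple) (auto simp: poly_QP)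

text \<open>The orders of the roots of \<open>QP r \<alpha>\<close> add up to its degree
  \<open>10 * r - 5\<close>, of which \<open>y\<close> and \<open>- y\<close> take \<open>r\<close>
  each.\<close>

lemma card_black_simple: "card (poly (QP r \<alpha>) -` {0} - {y, - y}) = 8 * r - 5"
proof -
  let ?B = "poly (QP r \<alpha>) -` {0}"
  have "QP r \<alpha> \<noteq> 0" using deg_pos by auto
  then have "10 * r - 5 = (\<Sum>v\<in>?B. order v (QP r \<alpha>))"
    using sum_order_eq_degree [of "QP r \<alpha>"] degree_QP by (simp add: vimage_def)
  also have "\<dots> = (\<Sum>v\<in>?B - {y, - y}. order v (QP r \<alpha>)) + (\<Sum>v\<in>{y, - y}. order v (QP r \<alpha>))"
    by (rule sum.subset_diff [OF black_critical finite_black])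
  also have "\<dots> = card (?B - {y, - y}) + 2 * r"
    using y_neq_minus_y order_QP_black_simple order_QP_critical by simp
  finally show ?thesis by simp
qed

lemma passport_QP:
  "passport (shabat_tree (QP r \<alpha>) 0 1) =
     (replicate_mset 2 r + replicate_mset (8 * r - 5) 1, replicate_mset (2 * r - 1) 5, 10 * r - 5)"
proof -
  let ?B = "poly (QP r \<alpha>) -` {0}" and ?W = "poly (QP r \<alpha>) -` {1}"
  let ?d = "\<lambda>v. order v (QP r \<alpha> - [:poly (QP r \<alpha>) v:])"
  have "mset_set ?B = mset_set {y, - y} + mset_set (?B - {y, - y})"
    using black_critical finite_black by (subst mset_set_Union [symmetric]) (auto intro: arg_cong [of _ _ mset_set])
  then have "image_mset ?d (mset_set ?B) =
      image_mset ?d (mset_set {y, - y}) + image_mset ?d (mset_set (?B - {y, - y}))"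
    by simp
  also have "image_mset ?d (mset_set {y, - y}) = image_mset (\<lambda>v. r) (mset_set {y, - y})"
    using black_critical order_QP_critical by (intro image_mset_cong) auto
  also have "\<dots> = replicate_mset 2 r"
    using y_neq_minus_y by (simp add: image_mset_const_eq numeral_2_eq_2)
  also have "image_mset ?d (mset_set (?B - {y, - y})) = image_mset (\<lambda>v. 1) (mset_set (?B - {y, - y}))"
    using order_QP_black_simple finite_black by (intro image_mset_cong) auto
  also have "\<dots> = replicate_mset (8 * r - 5) 1"
    using card_black_simple by (simp add: image_mset_const_eq)
  finally have black: "image_mset ?d (mset_set ?B) = replicate_mset 2 r + replicate_mset (8 * r - 5) 1" .
  have "image_mset ?d (mset_set ?W) = image_mset (\<lambda>v. 5) (mset_set ?W)"
    using order_QP_white finite_white by (intro image_mset_cong) auto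
  also have "\<dots> = replicate_mset (2 * r - 1) 5"
    using card_white by (simp add: image_mset_const_eq)
  finally have white: "image_mset ?d (mset_set ?W) = replicate_mset (2 * r - 1) 5" .
  show ?thesis
    using black white card_edges by (simp add: passport_def shabat_tree_def degree_QP)
qed

end

section \<open>Classification by passport\<close>

lemma fifth_root_exists: "\<exists>k::complex. k ^ 5 = z"
proof (cases "z = 0")
  case False
  have "exp (Ln z / 5) ^ 5 = exp (5 * (Ln z / 5))" by (subst exp_of_nat_mult [symmetric]) simp
  then show ?thesis using False by auto
qed auto

lemma passport_count:
  assumes "passport (shabat_tree f c1 c2) = (b, w, n)"
  shows "b = image_mset (\<lambda>v. order v (f - [:poly f v:])) (mset_set (poly f -` {c1}))"
    "w = image_mset (\<lambda>v. order v (f - [:poly f v:])) (mset_set (poly f -` {c2}))"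
  using assms by (simp_all add: passport_def shabat_tree_def)

text \<open>The linear factorisation is a fifth power up to the leading coefficient, which is itself
  a fifth power in the complex numbers.\<close>

lemma eq_power_if_roots_multiplicity:
  fixes f :: "complex poly"
  assumes "f \<noteq> 0" "\<And>v. poly f v = 0 \<Longrightarrow> order v f = 5"
  obtains h where "f = h ^ 5" "degree h = card {v. poly f v = 0}"
proof -
  obtain k where k: "k ^ 5 = lead_coeff f" using fifth_root_exists by blast
  have "k \<noteq> 0" using k assms(1) by auto
  define h where "h = smult k (\<Prod>z | poly f z = 0. [:- z, 1:])"
  have "f = smult (lead_coeff f) (\<Prod>z | poly f z = 0. [:- z, 1:] ^ order z f)"
    by (simp add: complex_poly_decompose)
  also have "(\<Prod>z | poly f z = 0. [:- z, 1:] ^ order z f) = (\<Prod>z | poly f z = 0. [:- z, 1:]) ^ 5"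
    using assms(2) by (simp add: prod_power_distrib)
  finally have "f = h ^ 5" by (simp add: h_def smult_power k)
  moreover have "degree h = card {v. poly f v = 0}"
    using \<open>k \<noteq> 0\<close> unfolding h_def by (simp add: degree_prod_sum_eq)
  ultimately show ?thesis by (rule that)
qed

lemma eq_smult_add_const_if_pderiv:
  fixes p q :: "complex poly"
  assumes "pderiv p = smult c (pderiv q)"
  obtains m where "p = smult c q + [:m:]"
proof -
  have "pderiv (p - smult c q) = 0" using assms by (simp add: pderiv_diff pderiv_smult)
  then obtain m where "p - smult c q = [:m:]" using pderiv_iszero by blast
  then have "p = smult c q + [:m:]" by (simp add: algebra_simps)
  then show ?thesis by (rule that)
qed

text \<open>The affine map that sends \<open>y\<close> to \<open>a\<close> and \<open>- y\<close> to
  \<open>b\<close> makes the two derivatives proportional, so the polynomials agree up to a factor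
  \<open>l\<close> and a constant \<open>m\<close>. The values at \<open>a\<close> and
  \<open>b\<close> are the two equations from which \<open>l\<close> and \<open>m\<close> are found
  later.\<close>

lemma (in fifth_root_data) affine_pullback:
  fixes h :: "complex poly"
  assumes ab: "a \<noteq> b" and c: "c \<noteq> 0"
    and h: "pderiv h = smult c ([:- a, 1:] ^ (r - 1) * [:- b, 1:] ^ (r - 1))"
  obtains u w l m where "u \<noteq> 0" "l \<noteq> 0" "h \<circ>\<^sub>p [:w, u:] = smult l P + [:m:]"
    "poly h a = l * \<tau> + m" "poly h b = l * \<tau> ^ 4 + m"
proof -
  define u where "u = (a - b) / (2 * y)"
  define w where "w = (a + b) / 2"
  have u: "u \<noteq> 0" using ab y_nonzero by (simp add: u_def)
  have wa: "w + u * y = a" and wb: "w - u * y = b"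
    using y_nonzero by (simp_all add: u_def w_def field_simps)
  obtain c' where c': "c' \<noteq> 0" "pderiv P = smult c' ([:- y, 1:] ^ (r - 1) * [:y, 1:] ^ (r - 1))"
    by (rule pderiv_P)
  have lin: "[:- a, 1:] \<circ>\<^sub>p [:w, u:] = smult u [:- y, 1:]" "[:- b, 1:] \<circ>\<^sub>p [:w, u:] = smult u [:y, 1:]"
    by (simp_all add: pcompose_pCons flip: wa wb)
  define l where "l = c * u ^ (r - 1) * u ^ (r - 1) * u / c'"
  have "pderiv (h \<circ>\<^sub>p [:w, u:]) = smult u (pderiv h \<circ>\<^sub>p [:w, u:])"
    by (simp add: pderiv_pcompose pderiv_pCons)
  also have "\<dots> = smult (c * u ^ (r - 1) * u ^ (r - 1) * u) ([:- y, 1:] ^ (r - 1) * [:y, 1:] ^ (r - 1))"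
    unfolding h pcompose_smult pcompose_mult pcompose_power lin
    by (simp only: smult_power mult_smult_left mult_smult_right smult_smult mult_ac)
  also have "\<dots> = smult l (pderiv P)"
    using c'(1) by (simp add: c'(2) l_def)
  finally obtain m where m: "h \<circ>\<^sub>p [:w, u:] = smult l P + [:m:]"
    by (rule eq_smult_add_const_if_pderiv)
  have ev: "poly h (w + u * x) = l * poly P x + m" for x
    using arg_cong [OF m, of "\<lambda>p. poly p x"] by (simp add: poly_pcompose mult.commute)
  have "l \<noteq> 0" using c c' u by (simp add: l_def)
  moreover have "poly h a = l * \<tau> + m" "poly h b = l * \<tau> ^ 4 + m"
    using ev [of y] ev [of "- y"] by (simp_all add: wa wb P_y P_minus_y)
  ultimately show ?thesis using that u m by blast
qed

text \<open>The rigidity is a degree count: \<open>h\<close> has one simple root per white vertex,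
  so \<open>pderiv h\<close> has degree \<open>2 * (r - 1)\<close>, and two zeros of order
  \<open>r - 1\<close> exhaust it. What remains free is an affine substitution and the ratio of the
  two critical values.\<close>

lemma shabat_passport_imp_equiv:
  fixes r s p n :: nat
  assumes r: "r \<ge> 2" and p: "p = 2 * r - 1"
    and f: "shabat f c1 c2"
    and pass: "passport (shabat_tree f c1 c2) = (replicate_mset 2 r + replicate_mset s 1, replicate_mset p 5, n)"
  obtains \<alpha> where "\<alpha> \<in> {complex_of_real (sqrt 5), - complex_of_real (sqrt 5)}"
    "shabat_equiv (QP r \<alpha>) 0 1 f c1 c2"
proof -
  have deg: "degree f > 0" and c12: "c1 \<noteq> c2" using f by (auto simp: shabat_def)
  let ?W = "poly f -` {c2}" and ?B = "poly f -` {c1}"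
  have finW: "finite ?W" and finB: "finite ?B"
    using finite_poly_fiber [OF deg] by (simp_all add: vimage_def)
  note white = passport_count(2) [OF pass] and black = passport_count(1) [OF pass]
  \<comment> \<open>Normalised to be 0 over \<open>c2\<close> and 1 over \<open>c1\<close>, so that
    \<open>h\<close> takes fifth roots of unity at the black vertices.\<close>
  define g where "g = smult (1 / (c1 - c2)) (f - [:c2:])"
  have g_roots: "{v. poly g v = 0} = ?W" using c12 by (auto simp: g_def)
  have "g \<noteq> 0" using poly_minus_const_neq_0 [OF deg] c12 by (simp add: g_def)
  moreover have "order v g = 5" if "poly g v = 0" for v
  proof -
    have v: "v \<in> ?W" using that g_roots by blast
    then have "order v (f - [:poly f v:]) \<in># replicate_mset p 5"
      unfolding white using finW by simp
    then show ?thesis using v c12 by (simp add: g_def order_smult split: if_splits)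
  qed
  ultimately obtain h where h: "g = h ^ 5" "degree h = card {v. poly g v = 0}"
    by (rule eq_power_if_roots_multiplicity)
  have "card ?W = p" using arg_cong [OF white, of size] by simp
  then have degh: "degree h = 2 * r - 1" using h(2) g_roots p by simp
  have f_h: "f = [:c2:] + smult (c1 - c2) (h ^ 5)"
    using c12 unfolding h(1) [symmetric] by (simp add: g_def)
  have "card {v \<in> ?B. order v (f - [:poly f v:]) = r} = 2"
  proof -
    \<comment> \<open>\<open>r \<ge> 2\<close> separates the two special vertices from those of
      degree 1.\<close>
    have "count (replicate_mset 2 r + replicate_mset s 1) r = 2" using r by simp
    then show ?thesis unfolding black using finB by (simp add: count_image_mset_eq_card_vimage)
  qed
  then obtain a b where ab: "a \<noteq> b" "{v \<in> ?B. order v (f - [:poly f v:]) = r} = {a, b}"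
    by (auto simp: card_2_iff)
  have pf: "pderiv f = smult (5 * (c1 - c2)) (h ^ 4 * pderiv h)"
  proof -
    have "pderiv (h ^ Suc 4) = smult 5 (h ^ 4 * pderiv h)"
      by (simp only: pderiv_power_Suc) simp
    then show ?thesis by (subst f_h) (simp add: pderiv_add pderiv_smult pderiv_pCons mult.commute)
  qed
  have ev: "poly f v = c2 + (c1 - c2) * poly h v ^ 5" for v
    by (subst f_h) simp
  have crit: "poly h v ^ 5 = 1 \<and> order v (pderiv h) = r - 1" if "v \<in> {a, b}" for v
  proof -
    have v: "poly f v = c1" "order v (f - [:c1:]) = r" using that ab(2) by auto
    then have "(c1 - c2) * (poly h v ^ 5 - 1) = 0" using ev [of v] by (simp add: algebra_simps)
    then have h5: "poly h v ^ 5 = 1" using c12 by simp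
    then have "poly h v \<noteq> 0" by auto
    have "order v (pderiv f) = r - 1"
      using order_pderiv [OF poly_minus_const_neq_0 [OF deg, of c1], of v] v
      by (simp add: pderiv_diff pderiv_pCons)
    moreover have "pderiv f \<noteq> 0" using deg by (simp add: pderiv_eq_0_iff)
    then have "order v (pderiv f) = order v (h ^ 4) + order v (pderiv h)"
      unfolding pf using c12 by (subst order_smult) (auto simp: order_mult)
    moreover have "order v (h ^ 4) = 0" using \<open>poly h v \<noteq> 0\<close> by (simp add: order_0I)
    ultimately show ?thesis using h5 by simp
  qed
  obtain c where c: "c \<noteq> 0" "pderiv h = smult c ([:- a, 1:] ^ (r - 1) * [:- b, 1:] ^ (r - 1))"
  proof -
    have degh': "degree (pderiv h) = (r - 1) + (r - 1)" using degh r by (simp add: degree_pderiv)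
    then have nz: "pderiv h \<noteq> 0" using r by auto
    obtain q where q: "pderiv h = [:- a, 1:] ^ (r - 1) * q"
      using order_1 [of a "pderiv h"] crit by (auto elim: dvdE)
    have "q \<noteq> 0" using nz q by auto
    have "order b (pderiv h) = order b ([:- a, 1:] ^ (r - 1)) + order b q"
      using nz unfolding q by (simp add: order_mult)
    moreover have "order b ([:- a, 1:] ^ (r - 1)) = 0" using ab(1) by (intro order_0I) simp
    ultimately have "order b q = r - 1" using crit by simp
    then obtain q' where q': "q = [:- b, 1:] ^ (r - 1) * q'"
      using order_1 [of b q] by (auto elim: dvdE)
    have "q' \<noteq> 0" using \<open>q \<noteq> 0\<close> q' by auto
    then have "degree (pderiv h) = (r - 1) + ((r - 1) + degree q')"
      unfolding q q' by (simp add: degree_mult_eq degree_power_eq)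
    then have "degree q' = 0" using degh' by simp
    then obtain c where "q' = [:c:]" by (rule degree_eq_zeroE)
    then show ?thesis using \<open>q' \<noteq> 0\<close> q q' by (intro that [of c]) (auto simp: mult_ac)
  qed
  define z where "z = poly h a / poly h b"
  have hb: "poly h b \<noteq> 0" using crit [of b] by auto
  have z5: "z ^ 5 = 1" using crit by (simp add: z_def power_divide)
  \<comment> \<open>The pullback works for every admissible root, so any instance \<open>t\<close>
    can be used before the right one is known: \<open>poly h a - poly h b = l * (t - t ^ 4)\<close>
    is nonzero.\<close>
  have "z \<noteq> 1"
  proof -
    define t where "t = cis (2 * pi / 5)"
    have "t ^ 5 = cis (2 * pi)" unfolding t_def Complex.DeMoivre by (rule arg_cong [of _ _ cis]) simp
    then have t5: "t ^ 5 = 1" by simp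
    have "t \<noteq> 1"
    proof
      assume "t = 1"
      then have "cos (2 * pi / 5) = 1" by (metis cis.sel(1) one_complex.sel(1) t_def)
      then show False using cos_monotone_0_pi [of 0 "2 * pi / 5"] by simp
    qed
    interpret fifth_root_data r "- 1 - 2 * (t + t ^ 4)" t
      using r t5 \<open>t \<noteq> 1\<close> by unfold_locales auto
    obtain l m where "l \<noteq> 0" "poly h a = l * t + m" "poly h b = l * t ^ 4 + m"
      using affine_pullback [OF ab(1) c] by metis
    then show ?thesis using tau_neq_inverse hb by (auto simp: z_def)
  qed
  \<comment> \<open>The quotient of the two critical values of \<open>P\<close> is \<open>\<tau> / \<tau> ^ 4 = \<tau>\<^sup>2\<close>, and \<open>z = (z ^ 3)\<^sup>2\<close>.\<close>
  define \<tau> where "\<tau> = z ^ 3"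
  define \<alpha> where "\<alpha> = - 1 - 2 * (\<tau> + \<tau> ^ 4)"
  have tau5: "\<tau> ^ 5 = 1" using z5 by (metis \<tau>_def mult.commute power_mult power_one)
  have "\<tau> \<noteq> 1"
  proof
    assume "\<tau> = 1"
    then have "z = 1" using z5 unfolding \<tau>_def by algebra
    then show False using \<open>z \<noteq> 1\<close> by simp
  qed
  interpret fifth_root_data r \<alpha> \<tau>
    using r tau5 \<open>\<tau> \<noteq> 1\<close> \<alpha>_def by unfold_locales auto
  obtain u w l m where uw: "u \<noteq> 0" "l \<noteq> 0" "h \<circ>\<^sub>p [:w, u:] = smult l P + [:m:]"
    and ha: "poly h a = l * \<tau> + m" and hb': "poly h b = l * \<tau> ^ 4 + m"
    by (rule affine_pullback [OF ab(1) c])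
  \<comment> \<open>The choice of \<open>\<tau>\<close> makes \<open>h\<close> and
    \<open>e * P\<close> agree at the two critical points, which forces \<open>l = e\<close> and
    \<open>m = 0\<close>. As \<open>e\<close> is a fifth root of unity, it disappears in
    \<open>h ^ 5\<close>.\<close>
  define e where "e = poly h a / \<tau>"
  have e1: "poly h a = e * \<tau>" using tau_nonzero by (simp add: e_def)
  have e5: "e ^ 5 = 1" using crit tau5 by (simp add: e_def power_divide)
  have e2: "poly h b = e * \<tau> ^ 4"
  proof -
    have "z * poly h b = e * \<tau>" using e1 hb by (simp add: z_def)
    then have "poly h b = e * (z ^ 3) ^ 4"
      unfolding \<tau>_def using z5 by algebra
    then show ?thesis by (simp add: \<tau>_def)
  qed
  have "(l - e) * (\<tau> - \<tau> ^ 4) = 0" using ha hb' e1 e2 by algebra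
  then have "l = e" using tau_neq_inverse by simp
  moreover have "m = 0" using ha e1 \<open>l = e\<close> by simp
  ultimately have "h \<circ>\<^sub>p [:w, u:] = smult e P" using uw(3) by simp
  then have "(h ^ 5) \<circ>\<^sub>p [:w, u:] = P ^ 5" by (simp add: pcompose_power smult_power e5)
  then have "f \<circ>\<^sub>p [:w, u:] = [:c2:] + smult (c1 - c2) (P ^ 5)"
    by (subst f_h) (simp add: pcompose_add pcompose_smult)
  also have "\<dots> = smult (c2 - c1) (QP r \<alpha>) + [:c1:]"
    by (simp add: QP_altdef smult_diff_right smult_diff_left one_pCons)
  \<comment> \<open>Composition with the inverse substitution moves the affine map from
    \<open>f\<close> to \<open>QP r \<alpha>\<close>, as the definition of equivalence
    demands.\<close>
  finally have "(f \<circ>\<^sub>p [:w, u:]) \<circ>\<^sub>p [:- w / u, 1 / u:] =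
      (smult (c2 - c1) (QP r \<alpha>) + [:c1:]) \<circ>\<^sub>p [:- w / u, 1 / u:]" by simp
  moreover have "(f \<circ>\<^sub>p [:w, u:]) \<circ>\<^sub>p [:- w / u, 1 / u:] = f"
    using uw(1) by (simp add: pcompose_assoc [symmetric] pcompose_pCons)
  ultimately have "f = smult (c2 - c1) (QP r \<alpha> \<circ>\<^sub>p [:- w / u, 1 / u:]) + [:c1:]"
    by (simp add: pcompose_add pcompose_smult)
  then have "shabat_equiv (QP r \<alpha>) 0 1 f c1 c2"
    unfolding shabat_equiv_def using c12 uw(1)
    by (intro exI [of _ "c2 - c1"] exI [of _ c1] exI [of _ "1 / u"] exI [of _ "- w / u"]) simp
  moreover have "\<alpha> \<in> {complex_of_real (sqrt 5), - complex_of_real (sqrt 5)}"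
  proof -
    have "\<alpha>\<^sup>2 = (complex_of_real (sqrt 5))\<^sup>2" using alpha_sq by (simp flip: of_real_power)
    then show ?thesis by (simp add: power2_eq_iff)
  qed
  ultimately show ?thesis by (intro that)
qed

section \<open>Rays and edges at the white vertices\<close>

context fifth_root_data
begin

text \<open>The choice of the point is immaterial, as the direction of \<open>P\<close> turns out to
  be constant along an edge.\<close>

definition "ray e = sgn (poly P (SOME z. z \<in> e))"

lemma edge_P_power:
  assumes "e \<in> es" "z \<in> e"
  obtains t where "0 < t" "t < 1" "poly P z ^ 5 = of_real t"
proof -
  have "poly (QP r \<alpha>) z \<in> seg" using edge_image assms by blast
  then obtain u where "0 < u" "u < 1" "1 - poly P z ^ 5 = of_real u"
    by (auto simp: in_segment poly_QP scaleR_conv_of_real)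
  then show ?thesis by (intro that [of "1 - u"]) (auto simp: algebra_simps)
qed

lemma edge_P_nonzero:
  assumes "e \<in> es" "z \<in> e"
  shows "poly P z \<noteq> 0"
  using edge_P_power [OF assms] by (metis of_real_eq_0_iff less_irrefl power_zero_numeral)

lemma finite_fifth_roots: "finite {w::complex. w ^ 5 = 1}"
  by (rule finite_roots_unity) simp

text \<open>On an edge \<open>poly P z ^ 5\<close> is a positive real, so the direction of
  \<open>poly P z\<close> has only five possible values, and connectedness leaves one.\<close>

lemma sgn_P_edge:
  assumes "e \<in> es" "z \<in> e"
  shows "sgn (poly P z) ^ 5 = 1" "sgn (poly P z) = ray e"
proof -
  have root: "sgn (poly P x) ^ 5 = 1" if x: "x \<in> e" for x
  proof -
    obtain t where "0 < t" "poly P x ^ 5 = of_real t" using edge_P_power [OF assms(1) x] by metis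
    then show ?thesis by (simp add: sgn_of_real flip: sgn_power_eq)
  qed
  then show "sgn (poly P z) ^ 5 = 1" using assms(2) .
  have "(\<lambda>x. sgn (poly P x)) constant_on e"
  proof (rule continuous_finite_range_constant)
    show "connected e" using edge_connected assms(1) .
    show "continuous_on e (\<lambda>x. sgn (poly P x))"
      unfolding sgn_div_norm using edge_P_nonzero [OF assms(1)] by (auto intro!: continuous_intros)
    show "finite ((\<lambda>x. sgn (poly P x)) ` e)"
      by (rule finite_subset [OF _ finite_fifth_roots]) (use root in auto)
  qed
  moreover have "(SOME z. z \<in> e) \<in> e" using assms(2) by (rule someI)
  ultimately show "sgn (poly P z) = ray e"
    unfolding ray_def constant_on_def using assms(2) by metis
qed

lemma ray_power: "e \<in> es \<Longrightarrow> ray e ^ 5 = 1"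
  using sgn_P_edge in_components_nonempty by (metis all_not_in_conv)

text \<open>A fifth root is determined once its direction is prescribed.\<close>

lemma edge_P_eq:
  assumes "e \<in> es" "e' \<in> es" "ray e = ray e'" "z \<in> e" "z' \<in> e'" "poly (QP r \<alpha>) z = poly (QP r \<alpha>) z'"
  shows "poly P z = poly P z'"
proof -
  have "poly P z ^ 5 = poly P z' ^ 5" using assms(6) by (simp add: poly_QP)
  then have "norm (poly P z) ^ 5 = norm (poly P z') ^ 5" by (metis norm_power)
  then have "norm (poly P z) = norm (poly P z')" by (simp add: power_eq_iff_eq_base)
  moreover have "sgn (poly P z) = sgn (poly P z')" using sgn_P_edge assms by metis
  moreover have "w = of_real (norm w) * sgn w" for w :: complex by (simp add: sgn_eq)
  ultimately show ?thesis by metis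
qed

text \<open>Near the common end both edges lie in a disc where \<open>P\<close> is injective. Two of
  their points over the same \<open>w\<close> have the same \<open>P\<close>-value, hence coincide,
  and edges are disjoint or equal. This applies at every vertex other than \<open>y\<close> and
  \<open>- y\<close>.\<close>

lemma edges_eq_if_same_ray:
  assumes "e \<in> es" "e' \<in> es" "ray e = ray e'" "v \<in> closure e" "v \<in> closure e'"
    and c: "poly (QP r \<alpha>) v = c" "c \<in> {0, 1}" and reg: "poly (pderiv P) v \<noteq> 0"
  shows "e = e'"
proof -
  obtain \<rho> where \<rho>: "\<rho> > 0" "inj_on (poly P) (ball v \<rho>)" using poly_locally_injective reg by blast
  obtain \<epsilon> where \<epsilon>: "\<epsilon> > 0" "e \<inter> poly (QP r \<alpha>) -` ball c \<epsilon> \<subseteq> ball v \<rho>"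
    using edge_near_endpoint [OF assms(1,4) c(1) \<rho>(1)] by metis
  obtain \<epsilon>' where \<epsilon>': "\<epsilon>' > 0" "e' \<inter> poly (QP r \<alpha>) -` ball c \<epsilon>' \<subseteq> ball v \<rho>"
    using edge_near_endpoint [OF assms(2,5) c(1) \<rho>(1)] by metis
  have "min \<epsilon> \<epsilon>' > 0" using \<epsilon>(1) \<epsilon>'(1) by simp
  then obtain w where w: "w \<in> seg" "w \<in> ball c (min \<epsilon> \<epsilon>')"
    using edge_meets_near_endpoint [OF assms(1) c(2)] by blast
  obtain z where z: "z \<in> e" "poly (QP r \<alpha>) z = w"
    using edge_image [OF assms(1)] w(1) by (metis imageE)
  obtain z' where z': "z' \<in> e'" "poly (QP r \<alpha>) z' = w"
    using edge_image [OF assms(2)] w(1) by (metis imageE)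
  have "z \<in> ball v \<rho>" "z' \<in> ball v \<rho>" using \<epsilon>(2) \<epsilon>'(2) z z' w(2) by auto
  moreover have "poly P z = poly P z'" using edge_P_eq assms(1-3) z z' by metis
  ultimately have "z = z'" using \<rho>(2) by (meson inj_onD)
  then show ?thesis using edges_eqI assms(1,2) z(1) z'(1) by blast
qed

text \<open>Lying on a given ray is a closed condition, so it passes to the end of the edge, where
  \<open>P\<close> has modulus 1.\<close>

lemma ray_eq_black:
  assumes "e \<in> es" "b \<in> closure e" "poly (QP r \<alpha>) b = 0"
  shows "ray e = poly P b"
proof -
  have "closed {z. poly P z = of_real (norm (poly P z)) * ray e}"
    by (intro closed_Collect_eq continuous_intros)
  moreover have "e \<subseteq> {z. poly P z = of_real (norm (poly P z)) * ray e}"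
  proof
    fix z assume "z \<in> e"
    have "poly P z = of_real (norm (poly P z)) * sgn (poly P z)"
      by (simp add: sgn_eq)
    then show "z \<in> {z. poly P z = of_real (norm (poly P z)) * ray e}"
      using sgn_P_edge(2) [OF assms(1) \<open>z \<in> e\<close>] by simp
  qed
  ultimately have b: "poly P b = of_real (norm (poly P b)) * ray e"
    using closure_minimal assms(2) by blast
  have "poly P b ^ 5 = 1" using assms(3) by (simp add: poly_QP)
  then have "norm (poly P b) ^ 5 = 1 ^ 5" by (metis norm_one norm_power power_one)
  then have "norm (poly P b) = 1" by (rule power_eq_imp_eq_base) auto
  then show ?thesis using b by simp
qed

section \<open>Counting edges by white vertex and ray\<close>

abbreviation "whites \<equiv> poly (QP r \<alpha>) -` {1}"

definition "white_end e = (SOME v. v \<in> closure e \<and> poly (QP r \<alpha>) v = 1)"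

definition "black_end e = (SOME v. v \<in> closure e \<and> poly (QP r \<alpha>) v = 0)"

lemma white_end:
  assumes "e \<in> es"
  shows "white_end e \<in> closure e" "poly (QP r \<alpha>) (white_end e) = 1"
proof -
  have "\<exists>v. v \<in> closure e \<and> poly (QP r \<alpha>) v = 1" using edge_endpoint [OF assms, of 1] by auto
  from someI_ex [OF this] show "white_end e \<in> closure e" "poly (QP r \<alpha>) (white_end e) = 1"
    by (simp_all add: white_end_def)
qed

lemma black_end:
  assumes "e \<in> es"
  shows "black_end e \<in> closure e" "poly (QP r \<alpha>) (black_end e) = 0"
proof -
  have "\<exists>v. v \<in> closure e \<and> poly (QP r \<alpha>) v = 0" using edge_endpoint [OF assms, of 0] by auto
  from someI_ex [OF this] show "black_end e \<in> closure e" "poly (QP r \<alpha>) (black_end e) = 0"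
    by (simp_all add: black_end_def)
qed

lemma white_regular: "poly (QP r \<alpha>) v = 1 \<Longrightarrow> poly (pderiv P) v \<noteq> 0"
  using P_y P_minus_y tau_nonzero by (auto simp: white_QP_iff critical_iff)

lemma white_end_ray_inj:
  assumes "e \<in> es" "e' \<in> es" "white_end e = white_end e'" "ray e = ray e'"
  shows "e = e'"
  using edges_eq_if_same_ray [OF assms(1,2,4), of "white_end e" 1] white_end [OF assms(1)]
    white_end [OF assms(2)] assms(3) white_regular by auto

text \<open>There are as many edges as pairs of a white vertex and a ray, so every pair is realised.\<close>

lemma white_end_ray_bij:
  "bij_betw (\<lambda>e. (white_end e, ray e)) es (whites \<times> {w. w ^ 5 = 1})"
proof -
  have inj: "inj_on (\<lambda>e. (white_end e, ray e)) es"
    using white_end_ray_inj by (auto intro!: inj_onI)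
  have "card (whites \<times> {w::complex. w ^ 5 = 1}) = (2 * r - 1) * 5"
    by (simp only: card_cartesian_product card_white card_roots_unity_eq)
  also have "\<dots> = card ((\<lambda>e. (white_end e, ray e)) ` es)"
    using r by (simp add: card_image [OF inj] card_edges degree_QP)
  finally have "(\<lambda>e. (white_end e, ray e)) ` es = whites \<times> {w. w ^ 5 = 1}"
    using white_end ray_power finite_white finite_fifth_roots
    by (intro card_subset_eq) auto
  then show ?thesis using inj by (simp add: bij_betw_def)
qed

lemma edge_exists:
  assumes "poly (QP r \<alpha>) v = 1" "w ^ 5 = 1"
  obtains e where "e \<in> es" "v \<in> closure e" "ray e = w"
proof -
  have "(v, w) \<in> (\<lambda>e. (white_end e, ray e)) ` es"
    using white_end_ray_bij assms by (simp add: bij_betw_def)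
  then obtain e where "e \<in> es" "white_end e = v" "ray e = w" by auto
  then show ?thesis using that white_end by blast
qed

lemma card_ray_edges:
  assumes "w ^ 5 = 1"
  shows "card {e \<in> es. ray e = w} = 2 * r - 1"
proof -
  have "bij_betw white_end {e \<in> es. ray e = w} whites"
  proof (rule bij_betwI')
    fix e e' assume "e \<in> {e \<in> es. ray e = w}" "e' \<in> {e \<in> es. ray e = w}"
    then have "e \<in> es" "e' \<in> es" "ray e = ray e'" by auto
    then show "white_end e = white_end e' \<longleftrightarrow> e = e'" using white_end_ray_inj by blast
  next
    fix e assume "e \<in> {e \<in> es. ray e = w}"
    then show "white_end e \<in> whites" using white_end by auto
  next
    fix v assume "v \<in> whites"
    then have "(v, w) \<in> (\<lambda>e. (white_end e, ray e)) ` es"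
      using white_end_ray_bij assms by (simp add: bij_betw_def)
    then show "\<exists>e\<in>{e \<in> es. ray e = w}. v = white_end e" by auto
  qed
  from bij_betw_same_card [OF this] show ?thesis by (simp only: card_white)
qed

text \<open>\<open>P - [:poly P x:]\<close> has degree \<open>2 * r - 1\<close> and a root of order
  \<open>r\<close> at \<open>x\<close>. The other critical point has a different value, so the
  remaining \<open>r - 1\<close> roots are simple.\<close>

lemma card_critical_fiber:
  assumes "x = y \<or> x = - y"
  shows "card ({v. poly P v = poly P x} - {x}) = r - 1"
proof -
  obtain c where c: "c \<noteq> 0" "pderiv P = smult c ([:- y, 1:] ^ (r - 1) * [:y, 1:] ^ (r - 1))"
    by (rule pderiv_P)
  define p where "p = P - [:poly P x:]"
  have degp: "degree P > 0" using degree_P r by simp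
  have p0: "p \<noteq> 0" unfolding p_def by (rule poly_minus_const_neq_0 [OF degp])
  have pd: "pderiv p = pderiv P" by (simp add: p_def pderiv_diff pderiv_pCons)
  have roots: "{v. poly p v = 0} = {v. poly P v = poly P x}" by (simp add: p_def)
  have "pderiv P = smult c ([:- x, 1:] ^ (r - 1) * [:x, 1:] ^ (r - 1))"
    using assms c(2) by (auto simp: mult.commute)
  then have "pderiv p = [:- x, 1:] ^ (r - 1) * smult c ([:x, 1:] ^ (r - 1))"
    unfolding pd by simp
  moreover have "poly (smult c ([:x, 1:] ^ (r - 1))) x \<noteq> 0"
    using c(1) assms y_nonzero by auto
  ultimately have "order x (pderiv p) = r - 1" by (metis order_linear_power_mult)
  then have ox: "order x p = r" using p0 r by (simp add: order_pderiv p_def)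
  have o1: "order v p = 1" if "v \<in> {v. poly P v = poly P x} - {x}" for v
  proof -
    have "v \<noteq> y \<and> v \<noteq> - y" using that assms P_y P_minus_y tau_neq_inverse by auto
    then have "poly (pderiv p) v \<noteq> 0" by (simp add: pd critical_iff)
    then show ?thesis using that p0 by (simp add: order_pderiv order_0I p_def)
  qed
  have "2 * r - 1 = degree p"
    using degree_P degp unfolding p_def
    by (metis diff_conv_add_uminus degree_add_eq_left degree_minus degree_pCons_0)
  also have "\<dots> = (\<Sum>v | poly P v = poly P x. order v p)"
    using sum_order_eq_degree [OF p0] roots by simp
  also have "\<dots> = order x p + (\<Sum>v\<in>{v. poly P v = poly P x} - {x}. order v p)"
    by (rule sum.remove) (use finite_poly_fiber [OF degp] in auto)
  also have "\<dots> = r + card ({v. poly P v = poly P x} - {x})"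
    using ox o1 by simp
  finally show ?thesis by simp
qed

lemma critical_black: "x = y \<or> x = - y \<Longrightarrow> poly (QP r \<alpha>) x = 0"
  using black_critical by auto

text \<open>Of the \<open>2 * r - 1\<close> edges over the ray through \<open>poly P x\<close>,
  those that miss \<open>x\<close> have distinct black ends among the other \<open>r - 1\<close>
  points of that fibre. At least \<open>r\<close> edges therefore end at \<open>x\<close>, and edges
  over the same ray have distinct white ends.\<close>

lemma card_white_adjacent_critical:
  assumes x: "x = y \<or> x = - y"
  shows "r \<le> card {v \<in> whites. \<exists>e\<in>es. v \<in> closure e \<and> x \<in> closure e}"
proof -
  define w where "w = poly P x"
  have w5: "w ^ 5 = 1" using critical_black [OF x] by (simp add: w_def poly_QP)
  define E where "E = {e \<in> es. ray e = w}"
  define N where "N = {e \<in> E. x \<notin> closure e}"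
  have finE: "finite E" unfolding E_def using finite_edges by simp
  have bP: "poly P (black_end e) = w" if "e \<in> E" for e
    using that ray_eq_black [of e "black_end e"] black_end [of e] by (simp add: E_def)
  have "card N \<le> card ({v. poly P v = poly P x} - {x})"
  proof (rule card_inj_on_le [of black_end])
    show "finite ({v. poly P v = poly P x} - {x})"
      using finite_poly_fiber [of P] degree_P r by auto
    show "black_end ` N \<subseteq> {v. poly P v = poly P x} - {x}"
      using bP black_end(1) by (auto simp: N_def E_def w_def)
    show "inj_on black_end N"
    proof (rule inj_onI)
      fix e e' assume e: "e \<in> N" "e' \<in> N" and eq: "black_end e = black_end e'"
      have E: "e \<in> es" "e' \<in> es" "ray e = ray e'" using e by (auto simp: N_def E_def)
      have "black_end e \<noteq> x" using e(1) black_end(1) E(1) by (auto simp: N_def)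
      moreover have "black_end e \<noteq> - x"
        using bP [of e] e(1) x P_y P_minus_y tau_neq_inverse by (auto simp: N_def w_def)
      ultimately have reg: "poly (pderiv P) (black_end e) \<noteq> 0" using x by (auto simp: critical_iff)
      have "black_end e \<in> closure e'" using black_end(1) [OF E(2)] eq by simp
      then show "e = e'"
        using edges_eq_if_same_ray [OF E black_end(1) [OF E(1)] _ black_end(2) [OF E(1)] _ reg] by simp
    qed
  qed
  also have "\<dots> = r - 1" by (rule card_critical_fiber [OF x])
  finally have "card N \<le> r - 1" .
  moreover have "card (E - N) = card E - card N"
    using finE by (intro card_Diff_subset) (auto simp: N_def)
  moreover have "card E = 2 * r - 1" using card_ray_edges [OF w5] by (simp add: E_def)
  ultimately have "r \<le> card (E - N)" using r by linarith
  also have "\<dots> \<le> card {v \<in> whites. \<exists>e\<in>es. v \<in> closure e \<and> x \<in> closure e}"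
  proof (rule card_inj_on_le [of white_end])
    show "inj_on white_end (E - N)"
    proof (rule inj_onI)
      fix e e' assume "e \<in> E - N" "e' \<in> E - N" and eq: "white_end e = white_end e'"
      then have "e \<in> es" "e' \<in> es" "ray e = ray e'" by (auto simp: E_def)
      then show "e = e'" using white_end_ray_inj eq by blast
    qed
    show "white_end ` (E - N) \<subseteq> {v \<in> whites. \<exists>e\<in>es. v \<in> closure e \<and> x \<in> closure e}"
      using white_end by (auto simp: E_def N_def)
    show "finite {v \<in> whites. \<exists>e\<in>es. v \<in> closure e \<and> x \<in> closure e}"
      by (rule finite_subset [OF _ finite_white]) auto
  qed
  finally show ?thesis .
qed

text \<open>Pigeonhole: each of the two vertices of degree \<open>r\<close> has \<open>r\<close> white neighbours,
  out of \<open>2 * r - 1\<close> in total.\<close>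

lemma central_vertex:
  obtains v e1 e2 where "poly (QP r \<alpha>) v = 1" "e1 \<in> es" "e2 \<in> es" "v \<in> closure e1" "v \<in> closure e2"
    "y \<in> closure e1" "- y \<in> closure e2"
proof -
  let ?A = "\<lambda>x. {v \<in> whites. \<exists>e\<in>es. v \<in> closure e \<and> x \<in> closure e}"
  have "?A y \<inter> ?A (- y) \<noteq> {}"
  proof
    assume empty: "?A y \<inter> ?A (- y) = {}"
    have fin: "finite (?A x)" for x by (rule finite_subset [OF _ finite_white]) auto
    have "card (?A y) + card (?A (- y)) = card (?A y \<union> ?A (- y))"
      by (rule card_Un_disjoint [OF fin fin empty, symmetric])
    also have "\<dots> \<le> card whites" using finite_white by (intro card_mono) auto
    finally show False
      using card_white_adjacent_critical [of y] card_white_adjacent_critical [of "- y"] card_white r by simp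
  qed
  then show ?thesis using that by auto
qed

text \<open>To first order \<open>P\<close> multiplies \<open>z - v\<close> by its derivative at
  \<open>v\<close>, so the edges leave \<open>v\<close> like the rays, turned by a common angle.
  This angle cancels in \<open>ccw\<close>.\<close>

lemma edge_dir_white:
  assumes "e \<in> es" "v \<in> closure e" "poly (QP r \<alpha>) v = 1"
  shows "edge_dir v e = ray e / sgn (poly (pderiv P) v)"
proof -
  have Pv: "poly P v = 0" using assms(3) by (simp add: white_QP_iff)
  have nz: "poly (pderiv P) v \<noteq> 0" using white_regular assms(3) .
  have "((\<lambda>z. (poly P z - poly P v) / (z - v)) \<longlongrightarrow> poly (pderiv P) v) (at v within e)"
    using poly_DERIV [of P v] has_field_derivative_at_within has_field_derivative_iff by blast
  then have "((\<lambda>z. ray e / sgn (poly P z / (z - v))) \<longlongrightarrow> ray e / sgn (poly (pderiv P) v)) (at v within e)"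
    using nz Pv by (intro tendsto_intros) (auto simp: sgn_zero_iff)
  moreover have "\<forall>\<^sub>F z in at v within e. ray e / sgn (poly P z / (z - v)) = sgn (z - v)"
  proof -
    have "ray e / sgn (poly P z / (z - v)) = sgn (z - v)" if "z \<in> e" "z \<noteq> v" for z
    proof -
      have "sgn (poly P z) \<noteq> 0" using edge_P_nonzero [OF assms(1) that(1)] by (simp add: sgn_zero_iff)
      then show ?thesis
        using that(2) unfolding sgn_P_edge(2) [OF assms(1) that(1), symmetric] sgn_divide
        by (simp add: sgn_zero_iff)
    qed
    then show ?thesis by (auto simp: eventually_at_filter)
  qed
  ultimately have "((\<lambda>z. sgn (z - v)) \<longlongrightarrow> ray e / sgn (poly (pderiv P) v)) (at v within e)"
    by (rule Lim_transform_eventually)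
  then show ?thesis
    unfolding edge_dir_def
    using endpoint_filter_nontrivial [OF assms(1) _ assms(3,2)] by (simp add: tendsto_Lim)
qed

lemma ccw_white:
  assumes "e1 \<in> es" "e2 \<in> es" "e3 \<in> es" "v \<in> closure e1" "v \<in> closure e2" "v \<in> closure e3"
    "poly (QP r \<alpha>) v = 1"
  shows "ccw v e1 e2 e3 \<longleftrightarrow>
    0 < Arg2pi (ray e2 / ray e1) \<and> Arg2pi (ray e2 / ray e1) < Arg2pi (ray e3 / ray e1)"
  using assms white_regular [OF assms(7)] by (simp add: ccw_def edge_dir_white sgn_zero_iff)

end

section \<open>Distinguishing the two trees\<close>

definition "zeta = cis (2 * pi / 5)"

lemma zeta_power: "zeta ^ j = cis (2 * pi * real j / 5)"
  unfolding zeta_def Complex.DeMoivre by (rule arg_cong [of _ _ cis]) simp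

lemma zeta5: "zeta ^ 5 = 1"
  by (simp add: zeta_power)

lemma Arg2pi_zeta_power: "j < 5 \<Longrightarrow> Arg2pi (zeta ^ j) = 2 * pi * real j / 5"
  by (rule Arg2pi_unique [of 1]) (simp_all add: zeta_power cis_conv_exp)

lemma Arg2pi_zeta: "Arg2pi zeta = 2 * pi / 5"
  using Arg2pi_zeta_power [of 1] by simp

lemma fifth_root_eq_zeta_power:
  assumes "w ^ 5 = 1"
  obtains j where "j < 5" "w = zeta ^ j"
proof -
  have "w \<in> (\<lambda>k. cis (2 * pi * real k / real 5)) ` {..<5}"
    using Complex.bij_betw_roots_unity [of 5] assms by (simp add: bij_betw_def)
  then show ?thesis using that by (auto simp: zeta_power)
qed

lemma zeta_neq_1: "zeta \<noteq> 1"
  using Arg2pi_zeta_power [of 1] Arg2pi_zeta_power [of 0] pi_gt_zero by auto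

lemma zeta_sq_neq_1: "zeta\<^sup>2 \<noteq> 1"
  using Arg2pi_zeta_power [of 2] Arg2pi_zeta_power [of 0] pi_gt_zero by auto

text \<open>That the square is 5 is already known; the sign is settled by
  \<open>cos (2 * pi / 5) > 0\<close>. Passing from \<open>zeta\<close> to its square replaces
  \<open>\<alpha>\<close> by its conjugate \<open>- \<alpha>\<close>.\<close>

lemma fifth_root_data_zeta:
  assumes "r \<ge> 2"
  shows "fifth_root_data r (- complex_of_real (sqrt 5)) zeta"
    and "fifth_root_data r (complex_of_real (sqrt 5)) (zeta\<^sup>2)"
proof -
  \<comment> \<open>The instance leaves \<open>\<alpha>\<close> in terms of \<open>zeta\<close>, so
    that \<open>alpha_sq\<close> is available before its sign is known.\<close>
  interpret fifth_root_data r "- 1 - 2 * (zeta + zeta ^ 4)" zeta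
    using assms zeta5 zeta_neq_1 by unfold_locales auto
  define c where "c = cos (2 * pi / 5)"
  have "cos (2 * pi / 5) = cos (2 * pi * real 4 / 5)" "sin (2 * pi / 5) = - sin (2 * pi * real 4 / 5)"
    using cos_2pi_minus [of "2 * pi / 5"] sin_2pi_minus [of "2 * pi / 5"] by (simp_all add: field_simps)
  then have "zeta + zeta ^ 4 = of_real (2 * c)"
    unfolding zeta_power by (simp add: zeta_def c_def complex_eq_iff)
  then have real: "- 1 - 2 * (zeta + zeta ^ 4) = - of_real (1 + 4 * c)" by simp
  have "(complex_of_real (1 + 4 * c))\<^sup>2 = of_real 5"
    using alpha_sq unfolding real power2_minus by simp
  then have "(1 + 4 * c)\<^sup>2 = 5"
    unfolding of_real_power [symmetric] of_real_eq_iff .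
  moreover have "c > 0" unfolding c_def by (rule cos_gt_zero) auto
  ultimately have sqrt5: "sqrt 5 = 1 + 4 * c" by (intro real_sqrt_unique) auto
  have s: "- complex_of_real (sqrt 5) = - 1 - 2 * (zeta + zeta ^ 4)"
    unfolding real sqrt5 ..
  then show "fifth_root_data r (- complex_of_real (sqrt 5)) zeta"
    using fifth_root_data_axioms by simp
  have "(zeta\<^sup>2) ^ 5 = 1" using zeta5 by (metis mult.commute power_mult power_one)
  moreover have "complex_of_real (sqrt 5) = - 1 - 2 * (zeta\<^sup>2 + (zeta\<^sup>2) ^ 4)"
    using s cyclotomic zeta5 by algebra
  ultimately show "fifth_root_data r (complex_of_real (sqrt 5)) (zeta\<^sup>2)"
    using assms zeta_sq_neq_1 by unfold_locales
qed

text \<open>Degrees force an isomorphism to send \<open>\<plusminus> S.y\<close> to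
  \<open>\<plusminus> T.y\<close>, so the edges from the central vertex to them go to edges over
  \<open>zeta ^ 2\<close> and \<open>zeta ^ 3\<close>. These are consecutive, whereas in the first
  tree some edge lies between the two in either direction of turning. Both directions matter because
  the isomorphism may swap the critical points.\<close>

lemma trees_not_iso:
  assumes r: "r \<ge> 2"
  shows "\<not> tree_iso (shabat_tree (QP r (- complex_of_real (sqrt 5))) 0 1)
                    (shabat_tree (QP r (complex_of_real (sqrt 5))) 0 1)"
    (is "\<not> tree_iso ?S ?T")
proof
  assume iso: "tree_iso ?S ?T"
  interpret S: fifth_root_data r "- complex_of_real (sqrt 5)" zeta
    by (rule fifth_root_data_zeta [OF r])
  interpret T: fifth_root_data r "complex_of_real (sqrt 5)" "zeta\<^sup>2"
    by (rule fifth_root_data_zeta [OF r])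
  let ?s = "poly (QP r (- complex_of_real (sqrt 5)))" and ?t = "poly (QP r (complex_of_real (sqrt 5)))"
  have S: "black ?S = ?s -` {0}" "white ?S = ?s -` {1}" "edges ?S = S.es"
    and T: "black ?T = ?t -` {0}" "white ?T = ?t -` {1}" "edges ?T = T.es"
    and degS: "deg ?S v = order v (QP r (- complex_of_real (sqrt 5)) - [:?s v:])"
    and degT: "deg ?T v = order v (QP r (complex_of_real (sqrt 5)) - [:?t v:])" for v
    by (simp_all add: shabat_tree_def)
  obtain \<phi> \<psi> where bij: "bij_betw \<phi> (?s -` {0}) (?t -` {0})" "bij_betw \<phi> (?s -` {1}) (?t -` {1})"
      "bij_betw \<psi> S.es T.es"
    and deg: "\<And>v. v \<in> ?s -` {0} \<union> ?s -` {1} \<Longrightarrow> deg ?T (\<phi> v) = deg ?S v"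
    and inc: "\<And>v e. v \<in> ?s -` {0} \<union> ?s -` {1} \<Longrightarrow> e \<in> S.es \<Longrightarrow>
        incident (\<phi> v) (\<psi> e) \<longleftrightarrow> incident v e"
    and ccw: "\<And>v e1 e2 e3. v \<in> ?s -` {0} \<union> ?s -` {1} \<Longrightarrow> e1 \<in> S.es \<Longrightarrow> e2 \<in> S.es \<Longrightarrow> e3 \<in> S.es \<Longrightarrow>
        incident v e1 \<and> incident v e2 \<and> incident v e3 \<Longrightarrow>
        ccw (\<phi> v) (\<psi> e1) (\<psi> e2) (\<psi> e3) \<longleftrightarrow> ccw v e1 e2 e3"
    using iso unfolding tree_iso_def S T by blast
  obtain v e1 e2 where v: "?s v = 1" and e: "e1 \<in> S.es" "e2 \<in> S.es" "v \<in> closure e1" "v \<in> closure e2"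
      "S.y \<in> closure e1" "- S.y \<in> closure e2"
    by (rule S.central_vertex)
  have y: "?s S.y = 0" "?s (- S.y) = 0" using S.critical_black by auto
  have rays: "S.ray e1 = zeta" "S.ray e2 = zeta ^ 4"
    using S.ray_eq_black [OF e(1) e(5) y(1)] S.ray_eq_black [OF e(2) e(6) y(2)] S.P_y S.P_minus_y by auto
  \<comment> \<open>\<open>a\<close> is met when turning counterclockwise from \<open>zeta\<close>
    to \<open>zeta ^ 4\<close>.\<close>
  obtain a where a: "a \<in> S.es" "v \<in> closure a" "S.ray a = zeta\<^sup>2"
    by (rule S.edge_exists [OF v T.tau5])
  \<comment> \<open>\<open>b\<close> is met on the way from \<open>zeta ^ 4\<close> back to
    \<open>zeta\<close>.\<close>
  obtain b where b: "b \<in> S.es" "v \<in> closure b" "S.ray b = 1"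
    by (rule S.edge_exists [OF v power_one])
  have zeta0: "zeta \<noteq> 0" using S.tau_nonzero .
  have "zeta\<^sup>2 / zeta = zeta ^ 1" "zeta ^ 4 / zeta = zeta ^ 3" "1 / zeta ^ 4 = zeta ^ 1" "zeta / zeta ^ 4 = zeta ^ 2"
    using zeta0 zeta5 by (simp_all add: field_simps eval_nat_numeral)
  then have ccwS: "ccw v e1 a e2" "ccw v e2 b e1"
    using e a b v rays
    by (simp_all add: S.ccw_white Arg2pi_zeta_power Arg2pi_zeta)
  define v' where "v' = \<phi> v"
  have v': "?t v' = 1" using bij_betwE [OF bij(2)] v by (simp add: v'_def)
  have psi: "\<psi> x \<in> T.es" if "x \<in> S.es" for x using bij_betwE [OF bij(3)] that by simp
  have ccwT: "ccw v' (\<psi> e1) (\<psi> a) (\<psi> e2)" "ccw v' (\<psi> e2) (\<psi> b) (\<psi> e1)"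
    using ccwS ccw [of v] e a b v by (simp_all add: v'_def incident_def)
  have inc': "v' \<in> closure (\<psi> x)" if "x \<in> S.es" "v \<in> closure x" for x
    using inc [of v x] that v by (simp add: v'_def incident_def)
  have phi_y: "\<phi> x = T.y \<or> \<phi> x = - T.y" if x: "x = S.y \<or> x = - S.y" for x
  proof (rule ccontr)
    assume "\<not> (\<phi> x = T.y \<or> \<phi> x = - T.y)"
    have x0: "?s x = 0" using S.critical_black [OF x] .
    then have t0: "?t (\<phi> x) = 0" using bij_betwE [OF bij(1)] by simp
    have "order (\<phi> x) (QP r (complex_of_real (sqrt 5))) = 1"
      using T.order_QP_black_simple t0 \<open>\<not> (\<phi> x = T.y \<or> \<phi> x = - T.y)\<close> by simp
    moreover have "order x (QP r (- complex_of_real (sqrt 5))) = r"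
      by (rule S.order_QP_critical [OF x])
    ultimately show False
      using deg [of x] x0 t0 r by (simp add: degS degT)
  qed
  have ray_T: "T.ray (\<psi> x) = poly (P_poly r (complex_of_real (sqrt 5))) (\<phi> w)"
    if "x \<in> S.es" "w \<in> closure x" "w = S.y \<or> w = - S.y" for x w
  proof (rule T.ray_eq_black [OF psi [OF that(1)]])
    have w: "?s w = 0" using S.critical_black [OF that(3)] .
    show "\<phi> w \<in> closure (\<psi> x)" using inc [of w x] that w by (simp add: incident_def)
    show "?t (\<phi> w) = 0" using bij_betwE [OF bij(1)] w by simp
  qed
  have zeta8: "(zeta\<^sup>2) ^ 4 = zeta ^ 3" using zeta5 by algebra
  have PT: "poly (P_poly r (complex_of_real (sqrt 5))) T.y = zeta\<^sup>2"
    "poly (P_poly r (complex_of_real (sqrt 5))) (- T.y) = zeta ^ 3"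
    using T.P_y T.P_minus_y zeta8 by auto
  \<comment> \<open>The angle from \<open>zeta ^ 2\<close> to \<open>zeta ^ 3\<close> is a single
    step of \<open>2 * pi / 5\<close>, and all rays differ by multiples of this step.\<close>
  have no_between: False
    if "c1 \<in> T.es" "c2 \<in> T.es" "c3 \<in> T.es" "v' \<in> closure c1" "v' \<in> closure c2" "v' \<in> closure c3"
      "T.ray c1 = zeta\<^sup>2" "T.ray c3 = zeta ^ 3" "ccw v' c1 c2 c3" for c1 c2 c3
  proof -
    have "(T.ray c2 / T.ray c1) ^ 5 = 1" using T.ray_power that(1,2) by (simp add: power_divide)
    then obtain j where j: "j < 5" "T.ray c2 / T.ray c1 = zeta ^ j" by (rule fifth_root_eq_zeta_power)
    have "T.ray c3 / T.ray c1 = zeta ^ 1"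
      using zeta0 that(7,8) by (simp add: eval_nat_numeral)
    then have "0 < Arg2pi (zeta ^ j)" "Arg2pi (zeta ^ j) < Arg2pi (zeta ^ 1)"
      using T.ccw_white [OF that(1-6) v'] that(9) j(2) by simp_all
    then have "0 < 2 * pi * real j / 5" "2 * pi * real j / 5 < 2 * pi * 1 / 5"
      using Arg2pi_zeta_power [OF j(1)] Arg2pi_zeta_power [of 1] by simp_all
    then show False by (cases j) (auto simp: field_simps mult_less_0_iff)
  qed
  have "\<phi> S.y \<noteq> \<phi> (- S.y)"
    using inj_onD [OF bij_betw_imp_inj_on [OF bij(1)], of S.y "- S.y"] y S.y_neq_minus_y by blast
  then consider "\<phi> S.y = T.y" "\<phi> (- S.y) = - T.y" | "\<phi> S.y = - T.y" "\<phi> (- S.y) = T.y"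
    using phi_y by metis
  then show False
  proof cases
    case 1
    then show False
      using no_between [of "\<psi> e1" "\<psi> a" "\<psi> e2"] psi inc' e a ccwT(1) ray_T [of e1 S.y] ray_T [of e2 "- S.y"] PT
      by simp
  next
    case 2
    then show False
      using no_between [of "\<psi> e2" "\<psi> b" "\<psi> e1"] psi inc' e b ccwT(2) ray_T [of e1 S.y] ray_T [of e2 "- S.y"] PT
      by simp
  qed
qed

section \<open>The classification of the trees\<close>

theorem lemma8p1:
  fixes r s p n :: nat
  assumes "r \<ge> 2" and "s > 0" and "p > 0" and "n > 0"
    and "n = 5 * p" and "n = 2 * r + s" and "p + s + 2 = n + 1"
  shows
    "(\<forall>\<alpha> \<in> {complex_of_real (sqrt 5), - complex_of_real (sqrt 5)}.
        shabat (QP r \<alpha>) 0 1 \<and>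
        passport (shabat_tree (QP r \<alpha>) 0 1) =
          (replicate_mset 2 r + replicate_mset s 1, replicate_mset p 5, n) \<and>
        (\<forall>f c1 c2. shabat f c1 c2 \<longrightarrow>
           (tree_iso (shabat_tree f c1 c2) (shabat_tree (QP r \<alpha>) 0 1) \<longleftrightarrow>
            shabat_equiv (QP r \<alpha>) 0 1 f c1 c2))) \<and>
     \<not> tree_iso (shabat_tree (QP r (complex_of_real (sqrt 5))) 0 1)
                (shabat_tree (QP r (- complex_of_real (sqrt 5))) 0 1) \<and>
     (\<forall>f c1 c2. shabat f c1 c2 \<and>
        passport (shabat_tree f c1 c2) =
          (replicate_mset 2 r + replicate_mset s 1, replicate_mset p 5, n) \<longrightarrow>
        (\<exists>\<alpha> \<in> {complex_of_real (sqrt 5), - complex_of_real (sqrt 5)}.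
           tree_iso (shabat_tree f c1 c2) (shabat_tree (QP r \<alpha>) 0 1)))"
proof -
  let ?R = "{complex_of_real (sqrt 5), - complex_of_real (sqrt 5)}"
  let ?T = "\<lambda>\<alpha>. shabat_tree (QP r \<alpha>) 0 1"
  let ?passport = "(replicate_mset 2 r + replicate_mset s 1, replicate_mset p 5, n)"
  \<comment> \<open>The Euler relation \<open>p + s + 2 = n + 1\<close> together with the two edge
    counts determines everything from \<open>r\<close>.\<close>
  have p: "p = 2 * r - 1" and s: "s = 8 * r - 5" and n: "n = 10 * r - 5" using assms by auto
  have shabat: "shabat (QP r \<alpha>) 0 1" and pass: "passport (?T \<alpha>) = ?passport" if "\<alpha> \<in> ?R" for \<alpha>
  proof -
    obtain \<tau> where "fifth_root_data r \<alpha> \<tau>"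
      using \<open>\<alpha> \<in> ?R\<close> fifth_root_data_zeta [OF assms(1)] by blast
    then show "shabat (QP r \<alpha>) 0 1" "passport (?T \<alpha>) = ?passport"
      unfolding p s n by (rule fifth_root_data.shabat_QP, rule fifth_root_data.passport_QP)
  qed
  have disjoint: "black (shabat_tree f c1 c2) \<inter> white (shabat_tree f c1 c2) = {}" if "shabat f c1 c2" for f c1 c2
    using that by (auto simp: shabat_def shabat_tree_def)
  have iso_sym: "tree_iso (shabat_tree g d1 d2) (shabat_tree f c1 c2)"
    if "tree_iso (shabat_tree f c1 c2) (shabat_tree g d1 d2)" "shabat f c1 c2" "shabat g d1 d2" for f g c1 c2 d1 d2
    using tree_iso_sym that disjoint by blast
  have classify: "\<exists>\<beta>\<in>?R. shabat_equiv (QP r \<beta>) 0 1 f c1 c2"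
    if "shabat f c1 c2" "passport (shabat_tree f c1 c2) = ?passport" for f c1 c2
    using shabat_passport_imp_equiv [OF assms(1) p that] by metis
  have not_iso: "\<alpha> = \<beta>" if "tree_iso (?T \<alpha>) (?T \<beta>)" "\<alpha> \<in> ?R" "\<beta> \<in> ?R" for \<alpha> \<beta>
    using trees_not_iso [OF assms(1)] iso_sym [OF that(1)] that shabat by auto
  have equiv_iso: "tree_iso (shabat_tree f c1 c2) (?T \<alpha>)"
    if "shabat_equiv (QP r \<alpha>) 0 1 f c1 c2" "shabat f c1 c2" "\<alpha> \<in> ?R" for f c1 c2 \<alpha>
    using iso_sym shabat_equiv_imp_tree_iso that shabat by blast
  \<comment> \<open>By its passport \<open>f\<close> is equivalent to some
    \<open>QP r \<beta>\<close>, whose tree is then isomorphic to that of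
    \<open>QP r \<alpha>\<close>. As the two explicit trees differ,
    \<open>\<beta> = \<alpha>\<close>.\<close>
  have iso_equiv: "shabat_equiv (QP r \<alpha>) 0 1 f c1 c2"
    if iso: "tree_iso (shabat_tree f c1 c2) (?T \<alpha>)" and f: "shabat f c1 c2" and \<alpha>: "\<alpha> \<in> ?R" for f c1 c2 \<alpha>
  proof -
    have "passport (shabat_tree f c1 c2) = ?passport"
      using tree_iso_passport [OF iso] pass \<alpha> by simp
    then obtain \<beta> where b: "\<beta> \<in> ?R" "shabat_equiv (QP r \<beta>) 0 1 f c1 c2"
      using classify f by blast
    have "\<beta> = \<alpha>"
      by (rule not_iso [OF tree_iso_trans [OF shabat_equiv_imp_tree_iso [OF shabat [OF b(1)] b(2)] iso] b(1) \<alpha>])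
    then show ?thesis using b(2) by simp
  qed
  have ne: "complex_of_real (sqrt 5) \<noteq> - complex_of_real (sqrt 5)"
    by (simp add: eq_neg_iff_add_eq_0)
  show ?thesis
  proof (intro conjI ballI allI impI)
    fix \<alpha> assume a: "\<alpha> \<in> ?R"
    show "shabat (QP r \<alpha>) 0 1" "passport (?T \<alpha>) = ?passport" using shabat pass a by blast+
    fix f c1 c2 assume "shabat f c1 c2"
    then show "tree_iso (shabat_tree f c1 c2) (?T \<alpha>) \<longleftrightarrow> shabat_equiv (QP r \<alpha>) 0 1 f c1 c2"
      using equiv_iso iso_equiv a by blast
  next
    show "\<not> tree_iso (?T (complex_of_real (sqrt 5))) (?T (- complex_of_real (sqrt 5)))"
      using not_iso [of "complex_of_real (sqrt 5)" "- complex_of_real (sqrt 5)"] ne by auto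
  next
    fix f c1 c2 assume "shabat f c1 c2 \<and> passport (shabat_tree f c1 c2) = ?passport"
    then show "\<exists>\<alpha>\<in>?R. tree_iso (shabat_tree f c1 c2) (?T \<alpha>)"
      using classify equiv_iso by blast
  qed
qed

end
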